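(* As $n\to\infty$, the following asymptotic relations hold: $$\sum_{k=0}^n\binom nk(-1)^k\mathrm{e}^{\sqrt k}\sim-\frac{1}{\sqrt{\pi\log n}},\qquad \sum_{k=0}^n\binom nk(-1)^k\mathrm{e}^{-\sqrt k}\sim\frac{1}{\sqrt{\pi\log n}},$$ $$\sum_{k=1}^n\binom nk(-1)^k\mathrm{e}^{1/k}\sim-\frac{\mathrm{e}^{2\sqrt{\log n}}}{2\sqrt\pi(\log n)^{1/4}},$$ $$\sum_{k=1}^n\binom nk(-1)^k\mathrm{e}^{-1/k}=-\frac{\cos\left(2\sqrt{\log n}-\tfrac14\pi\right)}{\sqrt\pi(\log n)^{1/4}}+\mathrm{o}\left((\log n)^{-1/4}\right).$$
   Context: The notation $a_n\sim b_n$ means $a_n/b_n\to1$ as $n\to\infty$. *)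

theory Defs
  imports Complex_Main "HOL-Library.Landau_Symbols"
begin

end

theory Submission
  imports Defs "HOL-Probability.Probability" "HOL-Complex_Analysis.Complex_Analysis"
    "HOL-Real_Asymp.Real_Asymp"
begin

text \<open>The coefficients are recognised as an average over the maximum of exponential random variables.
Suppose that $f(k) = k \int_0^\infty B(t)\, e^{-kt}\, dt$ for all $k \ge 1$. Since
$\sum_{k=1}^n \binom nk (-1)^k k e^{-kt} = - n e^{-t} (1 - e^{-t})^{n-1}$, and
$n e^{-t} (1 - e^{-t})^{n-1}$ is the density of the maximum $M_n$ of $n$ independent standard
exponential variables, $\sum_{k=1}^n \binom nk (-1)^k f(k) = - E[B(M_n)]$
(\<open>has_bochner_integral_alternating_binomial_sum\<close>). Now $M_n - \ln n$ converges in law to a Gumbel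
variable, so $M_n$ stays within $O(1)$ of $\ln n$, and if the amplitude and the phase of $B$ vary
slowly on the scale $O(1)$, then the sum is $-B(\ln n)$ to leading order. This is
\<open>alternating_binomial_sum_asymptotic\<close>, which reduces everything to the growth of the inverse
Laplace transform $B$ at infinity.

For $f(k) = 1 - e^{-\sqrt k}$, $B(t)$ is the error function at $1/(2\sqrt t)$, which is asymptotic to
$1/\sqrt{\pi t}$. For $f(k) = e^{c/k}$, expanding the exponential gives
$B(t) = \sum_m (ct)^m/(m!)^2$, that is, $I_0(2\sqrt t)$ for $c = 1$ and $J_0(2\sqrt t)$ for $c = -1$.
The behaviour of these Bessel functions at infinity comes from their integral representations over
$[0, \pi/2]$: by Laplace's method for $I_0$ (\<open>bessel_clifford_asymptotic_pos\<close>) and by stationary phase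
and a Fresnel integral for $J_0$ (\<open>bessel_clifford_asymptotic_neg\<close>).

The growing function $e^{\sqrt k}$ is reduced to the decaying one: it equals
$2\cosh\sqrt k - e^{-\sqrt k}$, and $\cosh\sqrt k$ is an entire function of $k$ of order $1/2$.
An alternating binomial sum of order $n$ kills all powers of degree below $n$, and what is left of the
power series of $\cosh\sqrt k$ is exponentially small (\<open>alternating_binomial_sum_cosh_sqrt_bound\<close>).\<close>

section \<open>Alternating binomial sums as averages over the maximum of exponentials\<close>

text \<open>The density of $M_n - \ln n$, where $M_n$ is the maximum of $n$ independent standard exponential
variables. In this scaling it converges to the Gumbel density $e^{-x - e^{-x}}$.\<close>
definition max_exp_density :: "nat \<Rightarrow> real \<Rightarrow> real" where
  "max_exp_density n x =
     (if x > - ln (real n) then exp (-x) * (1 - exp (-x) / real n) ^ (n - 1) else 0)"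

lemma max_exp_density_measurable [measurable]: "max_exp_density n \<in> borel_measurable borel"
  unfolding max_exp_density_def by measurable

text \<open>Both sides are $y\, \frac{d}{dy} (1-y)^n$.
At $y = e^{-t}$ it produces the density of the maximum of $n$ exponentials.\<close>
lemma sum_binomial_weighted_powers:
  fixes y :: real
  assumes "n > 0"
  shows "(\<Sum>k=1..n. real (n choose k) * (-1) ^ k * (real k * y ^ k)) = - (real n * y * (1 - y) ^ (n - 1))"
proof -
  obtain m where n: "n = Suc m" using assms by (cases n) auto
  have "(\<Sum>k=1..n. real (n choose k) * (-1) ^ k * (real k * y ^ k))
      = (\<Sum>k\<le>m. real (n choose Suc k) * (-1) ^ Suc k * (real (Suc k) * y ^ Suc k))"
    unfolding n by (simp add: sum.atLeast_Suc_atMost_Suc_shift atLeast0AtMost del: binomial_Suc_Suc sum.cl_ivl_Suc)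
  also have "\<dots> = (\<Sum>k\<le>m. - (real n * y) * (real (m choose k) * (-y) ^ k * 1 ^ (m - k)))"
  proof (rule sum.cong[OF refl])
    fix k
    have "real (Suc k) * real (n choose Suc k) = real n * real (m choose k)"
      unfolding n of_nat_mult[symmetric] by (simp only: Suc_times_binomial_eq mult.commute)
    then have "real (n choose Suc k) * (-1) ^ Suc k * (real (Suc k) * y ^ Suc k)
       = (real n * real (m choose k)) * (-1) ^ Suc k * y ^ Suc k"
      by (simp add: mult_ac)
    also have "\<dots> = - (real n * y) * (real (m choose k) * (-y) ^ k * 1 ^ (m - k))"
      by (simp add: power_minus[of y] mult_ac)
    finally show "real (n choose Suc k) * (-1) ^ Suc k * (real (Suc k) * y ^ Suc k) = \<dots>" .
  qed
  also have "\<dots> = - (real n * y) * ((-y) + 1) ^ m"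
    unfolding binomial_ring by (simp only: sum_distrib_left)
  finally show ?thesis by (simp add: n)
qed

text \<open>If \<open>f\<close> is \<open>k\<close> times the Laplace transform of \<open>B\<close>, then its alternating binomial sum is minus the
expected value of \<open>B\<close> at the maximum of \<open>n\<close> exponentials: only a finite sum is exchanged with the
integral, and the variable is shifted by \<open>ln n\<close>.\<close>
lemma has_bochner_integral_alternating_binomial_sum:
  fixes B f
  assumes n: "n > 0"
  assumes laplace: "\<And>k. k \<in> {1..n} \<Longrightarrow> has_bochner_integral lborel
              (\<lambda>t. indicator {0<..} t * (B t * exp (- (real k * t)))) (f k / real k)"
  shows "has_bochner_integral lborel (\<lambda>x. B (ln (real n) + x) * max_exp_density n x)
           (- (\<Sum>k=1..n. real (n choose k) * (-1) ^ k * f k))"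
proof -
  define g where "g t = indicator {0<..} t * (B t * (real n * exp (-t) * (1 - exp (-t)) ^ (n - 1)))" for t
  have "has_bochner_integral lborel
          (\<lambda>t. \<Sum>k=1..n. - (real (n choose k) * (-1) ^ k * real k) * (indicator {0<..} t * (B t * exp (- (real k * t)))))
          (\<Sum>k=1..n. - (real (n choose k) * (-1) ^ k * real k) * (f k / real k))"
    by (intro has_bochner_integral_sum has_bochner_integral_mult_right laplace) auto
  also have "(\<lambda>t. \<Sum>k=1..n. - (real (n choose k) * (-1) ^ k * real k) * (indicator {0<..} t * (B t * exp (- (real k * t))))) = g"
  proof
    fix t :: real
    have "(\<Sum>k=1..n. - (real (n choose k) * (-1) ^ k * real k) * (indicator {0<..} t * (B t * exp (- (real k * t)))))
       = - (indicator {0<..} t * B t) * (\<Sum>k=1..n. real (n choose k) * (-1) ^ k * (real k * exp (-t) ^ k))"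
      unfolding sum_distrib_left
      by (intro sum.cong refl) (simp add: exp_of_nat_mult[symmetric] mult_ac)
    also have "\<dots> = g t"
      unfolding sum_binomial_weighted_powers[OF n] g_def by simp
    finally show "(\<Sum>k=1..n. - (real (n choose k) * (-1) ^ k * real k) * (indicator {0<..} t * (B t * exp (- (real k * t))))) = g t" .
  qed
  also have "(\<Sum>k=1..n. - (real (n choose k) * (-1) ^ k * real k) * (f k / real k))
           = - (\<Sum>k=1..n. real (n choose k) * (-1) ^ k * f k)" (is "_ = ?S")
    unfolding sum_negf[symmetric] by (intro sum.cong) auto
  finally have "has_bochner_integral lborel (\<lambda>x. g (ln (real n) + 1 * x)) (?S / \<bar>1\<bar>)"
    by (subst (asm) lborel_has_bochner_integral_real_affine_iff[where c=1 and t="ln (real n)"]) simp_all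
  moreover have "g (ln (real n) + 1 * x) = B (ln (real n) + x) * max_exp_density n x" for x
    using n by (simp add: g_def max_exp_density_def exp_add exp_diff exp_minus field_simps split: split_indicator)
  ultimately show ?thesis by simp
qed

lemma max_exp_density_nonneg:
  assumes "n > 0" shows "max_exp_density n x \<ge> 0"
proof (cases "x > - ln (real n)")
  case True
  have "exp (-x) < exp (ln (real n))" using True by simp
  then have "exp (-x) / real n \<le> 1" using assms by simp
  then show ?thesis by (simp add: max_exp_density_def)
qed (simp add: max_exp_density_def)

text \<open>The factor $e^{-y/2}$, with $y = e^{-x}$, decays doubly exponentially as $x \to -\infty$; a bound that
is exponential in $x$ is enough for domination.\<close>
lemma mult_exp_neg_half_le:
  fixes y :: real assumes "y > 0" shows "y * exp (- y / 2) \<le> 8 / y"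
proof -
  have "1 + y/2 + (y/2)^2 / 2 \<le> exp (y/2)" using assms by (intro exp_lower_Taylor_quadratic) simp
  then have "y^2 / 8 \<le> exp (y/2)" using assms by (simp add: power_divide)
  then show ?thesis using assms by (simp add: exp_minus field_simps power2_eq_square)
qed

text \<open>A majorant that does not depend on \<open>n\<close>: to the right of 0 from $e^{-x}$ alone, and to the left from
$(1 - y/n)^{n-1} \le e^{-y/2}$ with $y = e^{-x}$.\<close>
lemma max_exp_density_le:
  assumes n: "n \<ge> 2"
  shows "max_exp_density n x \<le> 8 * exp (- \<bar>x\<bar>)"
proof (cases "x > - ln (real n)")
  case True
  define y where "y = exp (-x)"
  have y: "y > 0" by (simp add: y_def)
  have "exp (-x) < exp (ln (real n))" using True by simp
  then have yn: "y / real n \<le> 1" using n by (simp add: y_def)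
  have p: "max_exp_density n x = y * (1 - y / real n) ^ (n - 1)"
    using True by (simp add: max_exp_density_def y_def)
  show ?thesis
  proof (cases "x \<ge> 0")
    case True
    have "(1 - y / real n) ^ (n - 1) \<le> 1" using yn y by (intro power_le_one) auto
    then have "max_exp_density n x \<le> y * 1" unfolding p using y by (intro mult_left_mono) auto
    also have "\<dots> \<le> 8 * exp (- \<bar>x\<bar>)" using True by (simp add: y_def)
    finally show ?thesis .
  next
    case False
    have "(1 - y / real n) ^ (n - 1) \<le> exp (- (y / real n)) ^ (n - 1)"
      using yn exp_ge_add_one_self[of "- (y / real n)"] by (intro power_mono) auto
    also have "\<dots> = exp (- (y * (real (n - 1) / real n)))"
      by (simp add: exp_of_nat_mult[symmetric] mult_ac)
    also have "\<dots> \<le> exp (- y / 2)"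
    proof -
      have "1 / 2 \<le> real (n - 1) / real n" using n by (simp add: field_simps of_nat_diff)
      from mult_left_mono[OF this, of y] y have "y / 2 \<le> y * (real (n - 1) / real n)" by linarith
      then show ?thesis by simp
    qed
    finally have "max_exp_density n x \<le> y * exp (- y / 2)"
      unfolding p using y by (intro mult_left_mono) auto
    also have "\<dots> \<le> 8 / y" using y by (rule mult_exp_neg_half_le)
    also have "\<dots> = 8 * exp (- \<bar>x\<bar>)" using False by (simp add: y_def exp_minus field_simps)
    finally show ?thesis .
  qed
qed (simp add: max_exp_density_def)

lemma integrable_exp_neg_abs:
  fixes c :: real assumes "c > 0"
  shows "integrable lborel (\<lambda>x::real. exp (- (c * \<bar>x\<bar>)))"
proof -
  have 1: "integrable lborel (\<lambda>x::real. indicator {0<..} x * exp (- (x * c)))"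
    using integrable_I0i_exp_mscale[OF assms] by (simp add: set_integrable_def)
  have 2: "integrable lborel (\<lambda>x::real. indicator {0<..} (-x) * exp (- ((-x) * c)))"
    using lborel_integrable_real_affine[OF 1, of "-1" 0] by simp
  have "integrable lborel (\<lambda>x::real. indicator {0<..} x * exp (- (x * c)) + indicator {0<..} (-x) * exp (- ((-x) * c)))"
    by (rule Bochner_Integration.integrable_add[OF 1 2])
  also have "?this \<longleftrightarrow> ?thesis"
    using AE_lborel_singleton[of 0]
    by (intro integrable_cong_AE) (auto split: split_indicator simp: mult_ac)
  finally show ?thesis .
qed

text \<open>Dominated convergence against the densities. Growth of order $e^{|x|/2}$ is allowed because the
densities are bounded by a multiple of $e^{-|x|}$; half of this decay is kept for integrability.\<close>
lemma tendsto_integral_max_exp_density_zero: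
  fixes h :: "nat \<Rightarrow> real \<Rightarrow> real"
  assumes meas: "\<And>n. h n \<in> borel_measurable borel"
  assumes lim: "\<And>x. (\<lambda>n. h n x) \<longlonglongrightarrow> 0"
  assumes bound: "eventually (\<lambda>n. \<forall>x > - ln (real n). \<bar>h n x\<bar> \<le> C * exp (\<bar>x\<bar> / 2)) sequentially"
  shows "(\<lambda>n. \<integral>x. h n x * max_exp_density n x \<partial>lborel) \<longlonglongrightarrow> 0"
proof -
  obtain N where N: "N \<ge> 2" "\<And>n x. n \<ge> N \<Longrightarrow> x > - ln (real n) \<Longrightarrow> \<bar>h n x\<bar> \<le> C * exp (\<bar>x\<bar> / 2)"
  proof -
    from bound obtain N where "\<forall>n\<ge>N. \<forall>x > - ln (real n). \<bar>h n x\<bar> \<le> C * exp (\<bar>x\<bar> / 2)"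
      by (auto simp: eventually_sequentially)
    then show ?thesis by (intro that[of "max N 2"]) auto
  qed
  have "\<bar>h N 0\<bar> \<le> C * exp (\<bar>0\<bar> / 2)" using N by (intro N(2)) auto
  then have C: "C \<ge> 0" using abs_ge_zero[of "h N 0"] by (simp del: abs_ge_zero)
  have le: "\<bar>h n x * max_exp_density n x\<bar> \<le> C * 8 * exp (- (1/2 * \<bar>x\<bar>))" if n: "n \<ge> N" for n x
  proof (cases "x > - ln (real n)")
    case True
    have "\<bar>h n x * max_exp_density n x\<bar> \<le> (C * exp (\<bar>x\<bar> / 2)) * (8 * exp (- \<bar>x\<bar>))"
      unfolding abs_mult using N(2)[OF n True] max_exp_density_le[of n x] max_exp_density_nonneg[of n x] n N(1) C
      by (intro mult_mono) auto
    also have "\<dots> = C * 8 * exp (- (1/2 * \<bar>x\<bar>))"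
      by (simp add: exp_add[symmetric] field_simps exp_minus)
    finally show ?thesis .
  qed (use C in \<open>auto simp: max_exp_density_def\<close>)
  have "(\<lambda>n. \<integral>x. h (n + N) x * max_exp_density (n + N) x \<partial>lborel) \<longlonglongrightarrow> (\<integral>x. (0::real) \<partial>(lborel :: real measure))"
  proof (rule integral_dominated_convergence[where w = "\<lambda>x. C * 8 * exp (- (1/2 * \<bar>x\<bar>))"])
    show "integrable lborel (\<lambda>x::real. C * 8 * exp (- (1/2 * \<bar>x\<bar>)))"
      by (intro integrable_mult_right integrable_exp_neg_abs) auto
    show "AE x in lborel. norm (h (n + N) x * max_exp_density (n + N) x) \<le> C * 8 * exp (- (1/2 * \<bar>x\<bar>))" for n
      using le[of "n + N"] by auto
    show "AE x in lborel. (\<lambda>n. h (n + N) x * max_exp_density (n + N) x) \<longlonglongrightarrow> 0"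
    proof (rule AE_I2, rule Lim_null_comparison)
      fix x :: real
      show "eventually (\<lambda>n. norm (h (n + N) x * max_exp_density (n + N) x) \<le> \<bar>h (n + N) x\<bar> * (8 * exp (- \<bar>x\<bar>))) sequentially"
        using max_exp_density_le[of "_ + N" x] max_exp_density_nonneg[of "_ + N" x] N(1)
        by (intro always_eventually allI) (auto simp: abs_mult intro!: mult_left_mono)
      show "(\<lambda>n. \<bar>h (n + N) x\<bar> * (8 * exp (- \<bar>x\<bar>))) \<longlonglongrightarrow> 0"
        using LIMSEQ_ignore_initial_segment[OF lim[of x], of N]
        by (intro tendsto_mult_left_zero tendsto_rabs_zero)
    qed
  qed (use meas in \<open>auto\<close>)
  then have "(\<lambda>n. \<integral>x. h (n + N) x * max_exp_density (n + N) x \<partial>lborel) \<longlonglongrightarrow> 0" by simp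
  then show ?thesis by (rule LIMSEQ_offset[where k = N])
qed

lemma has_bochner_integral_power_exp_scaled:
  fixes u :: real
  assumes u: "u > 0"
  shows "has_bochner_integral lborel (\<lambda>t. indicator {0<..} t * (t ^ m * exp (- (u * t)))) (fact m / u ^ Suc m)"
proof -
  have "has_bochner_integral lborel (\<lambda>x. x^m * exp (-x) * indicator {0 <..} x::real) (fact m)"
    by (rule has_bochner_integral_I0i_power_exp_m)
  then have "has_bochner_integral lborel (\<lambda>x. (u * x)^m * exp (-(u * x)) * indicator {0 <..} (u * x)) (fact m / u)"
    using u by (subst (asm) lborel_has_bochner_integral_real_affine_iff[where c=u and t=0]) (simp_all add: field_simps)
  then have "has_bochner_integral lborel (\<lambda>x. 1 / u^m * ((u * x)^m * exp (-(u * x)) * indicator {0 <..} (u * x))) (1 / u^m * (fact m / u))"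
    by (rule has_bochner_integral_mult_right) 
  also have "(\<lambda>x. 1 / u^m * ((u * x)^m * exp (-(u * x)) * indicator {0 <..} (u * x))) =
     (\<lambda>t. indicator {0<..} t * (t ^ m * exp (- (u * t))))"
    using u by (auto simp: fun_eq_iff power_mult_distrib zero_less_mult_iff split: split_indicator)
  also have "1 / u^m * (fact m / u) = fact m / u ^ Suc m" by simp
  finally show ?thesis .
qed

text \<open>The total mass is 1 because $B = 1$ represents $f = 1$, and
$\sum_{k=1}^n \binom nk (-1)^k = -1$.\<close>
lemma has_bochner_integral_max_exp_density:
  assumes n: "n > 0"
  shows "has_bochner_integral lborel (max_exp_density n) 1"
proof -
  have "has_bochner_integral lborel (\<lambda>x. 1 * max_exp_density n x)
           (- (\<Sum>k=1..n. real (n choose k) * (-1) ^ k * 1))"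
    using has_bochner_integral_power_exp_scaled[where m=0]
    by (intro has_bochner_integral_alternating_binomial_sum n) simp
  also have "(\<Sum>k=1..n. real (n choose k) * (-1) ^ k * 1) = (\<Sum>k\<le>n. (-1) ^ k * real (n choose k)) - 1"
    by (simp add: atLeast0AtMost[symmetric] sum.atLeast_Suc_atMost mult.commute)
  also have "\<dots> = -1" using n by (simp add: choose_alternating_sum)
  finally show ?thesis by simp
qed

text \<open>The transfer principle. Here \<open>w\<close> is the amplitude of \<open>B\<close> and \<open>g\<close> the bounded, possibly oscillating, factor
that remains. Both are required to be insensitive to bounded shifts of the argument; the bound on
the ratio of shifted amplitudes supplies the majorant for dominated convergence.\<close>
lemma alternating_binomial_sum_asymptotic:
  fixes B w g :: "real \<Rightarrow> real" and f :: "nat \<Rightarrow> real"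
  assumes B: "B \<in> borel_measurable borel"
  assumes laplace: "\<And>k. k \<ge> 1 \<Longrightarrow> has_bochner_integral lborel
              (\<lambda>t. indicator {0<..} t * (B t * exp (- (real k * t)))) (f k / real k)"
  assumes w_pos: "\<And>t. t > 0 \<Longrightarrow> w t > 0"
  assumes w_shift: "\<And>x. ((\<lambda>L. w (L + x) / w L) \<longlongrightarrow> 1) at_top"
  assumes w_bound: "eventually (\<lambda>L. \<forall>x > -L. w (L + x) / w L \<le> C * exp (\<bar>x\<bar> / 2)) at_top"
  assumes B_bound: "\<And>t. t > 0 \<Longrightarrow> \<bar>B t\<bar> \<le> M * w t"
  assumes B_asymp: "((\<lambda>t. B t / w t - g t) \<longlongrightarrow> 0) at_top"
  assumes g_bound: "\<And>t. \<bar>g t\<bar> \<le> G"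
  assumes g_shift: "\<And>x. ((\<lambda>L. g (L + x) - g L) \<longlongrightarrow> 0) at_top"
  shows "(\<lambda>n. (\<Sum>k=1..n. real (n choose k) * (-1) ^ k * f k) / w (ln (real n)) + g (ln (real n)))
            \<longlonglongrightarrow> 0"
proof -
  define h where "h n x = B (ln (real n) + x) / w (ln (real n)) - g (ln (real n))" for n :: nat and x
  have ln_lim: "filterlim (\<lambda>n. ln (real n)) at_top sequentially"
    by real_asymp
  have M: "M \<ge> 0"
    using B_bound[of 1] w_pos[of 1] abs_ge_zero[of "B 1"] by (smt (verit) mult_neg_pos)
  have h_lim: "(\<lambda>n. h n x) \<longlonglongrightarrow> 0" for x
  proof -
    have shift: "filterlim (\<lambda>L::real. L + x) at_top at_top" by real_asymp
    have pos: "eventually (\<lambda>L. L + x > 0 \<and> L > 0) at_top"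
      by (rule eventually_mono[OF eventually_gt_at_top[of "\<bar>x\<bar>"]]) auto
    have "((\<lambda>L. B (L + x) / w (L + x) * (w (L + x) / w L - 1)) \<longlongrightarrow> 0) at_top"
    proof (rule Lim_null_comparison)
      show "eventually (\<lambda>L. norm (B (L + x) / w (L + x) * (w (L + x) / w L - 1)) \<le> M * \<bar>w (L + x) / w L - 1\<bar>) at_top"
        using pos
      proof eventually_elim
        case (elim L)
        have "\<bar>B (L + x) / w (L + x)\<bar> \<le> M"
          using elim B_bound[of "L + x"] w_pos[of "L + x"] by (simp add: abs_divide field_simps)
        then show ?case unfolding real_norm_def abs_mult by (intro mult_right_mono) auto
      qed
      show "((\<lambda>L. M * \<bar>w (L + x) / w L - 1\<bar>) \<longlongrightarrow> 0) at_top"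
        using w_shift[of x] by (intro tendsto_mult_right_zero tendsto_rabs_zero) (simp add: LIM_zero)
    qed
    \<comment> \<open>The three sources of error: the amplitude, the approximation of \<open>B / w\<close> by \<open>g\<close>, and the phase.\<close>
    from tendsto_add[OF this tendsto_add[OF filterlim_compose[OF B_asymp shift] g_shift[of x]]]
    have "((\<lambda>L. B (L + x) / w (L + x) * (w (L + x) / w L - 1) + (B (L + x) / w (L + x) - g (L + x) + (g (L + x) - g L))) \<longlongrightarrow> 0) at_top"
      by simp
    also have "?this \<longleftrightarrow> ((\<lambda>L. B (L + x) / w L - g L) \<longlongrightarrow> 0) at_top"
    proof (rule tendsto_cong, use pos in eventually_elim)
      case (elim L)
      then show ?case using w_pos[of L] w_pos[of "L + x"] by (simp add: field_simps)
    qed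
    finally show ?thesis unfolding h_def by (rule filterlim_compose[OF _ ln_lim])
  qed
  have "(\<lambda>n. \<integral>x. h n x * max_exp_density n x \<partial>lborel) \<longlonglongrightarrow> 0"
  proof (rule tendsto_integral_max_exp_density_zero[where C = "M * C + G"])
    show "h n \<in> borel_measurable borel" for n
      unfolding h_def using B by measurable
    show "(\<lambda>n. h n x) \<longlonglongrightarrow> 0" for x by (rule h_lim)
    show "eventually (\<lambda>n. \<forall>x > - ln (real n). \<bar>h n x\<bar> \<le> (M * C + G) * exp (\<bar>x\<bar> / 2)) sequentially"
      using filterlim_iff[THEN iffD1, OF ln_lim, rule_format, OF w_bound] eventually_gt_at_top[of 1]
    proof eventually_elim
      case (elim n)
      show ?case
      proof (intro allI impI)
        fix x assume x: "x > - ln (real n)"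
        have wn: "w (ln (real n)) > 0" using elim by (intro w_pos) simp
        have "\<bar>B (ln (real n) + x) / w (ln (real n))\<bar> \<le> M * (w (ln (real n) + x) / w (ln (real n)))"
          using B_bound[of "ln (real n) + x"] x wn by (simp add: abs_divide divide_right_mono)
        also have "\<dots> \<le> M * (C * exp (\<bar>x\<bar> / 2))"
          using elim x M by (intro mult_left_mono) auto
        finally have "\<bar>h n x\<bar> \<le> M * (C * exp (\<bar>x\<bar> / 2)) + G"
          unfolding h_def using g_bound[of "ln (real n)"] by linarith
        moreover have "G * 1 \<le> G * exp (\<bar>x\<bar> / 2)"
          using g_bound[of 0] by (intro mult_left_mono) auto
        ultimately show "\<bar>h n x\<bar> \<le> (M * C + G) * exp (\<bar>x\<bar> / 2)"
          by (simp add: algebra_simps)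
      qed
    qed
  qed
  then have lim: "(\<lambda>n. - (\<integral>x. h n x * max_exp_density n x \<partial>lborel)) \<longlonglongrightarrow> 0"
    using tendsto_minus by fastforce
  show ?thesis
  proof (rule Lim_transform_eventually[OF lim])
    show "eventually (\<lambda>n. - (\<integral>x. h n x * max_exp_density n x \<partial>lborel) =
       (\<Sum>k=1..n. real (n choose k) * (-1) ^ k * f k) / w (ln (real n)) + g (ln (real n))) sequentially"
      using eventually_gt_at_top[of 0]
    proof eventually_elim
      case (elim n)
      let ?S = "\<Sum>k=1..n. real (n choose k) * (-1) ^ k * f k"
      have 1: "has_bochner_integral lborel (\<lambda>x. B (ln (real n) + x) * max_exp_density n x) (- ?S)"
        using elim by (intro has_bochner_integral_alternating_binomial_sum[OF _ laplace]) auto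
      have "has_bochner_integral lborel
          (\<lambda>x. 1 / w (ln (real n)) * (B (ln (real n) + x) * max_exp_density n x) - g (ln (real n)) * max_exp_density n x)
          (1 / w (ln (real n)) * (- ?S) - g (ln (real n)) * 1)"
        by (rule has_bochner_integral_diff[OF has_bochner_integral_mult_right[OF 1]
                  has_bochner_integral_mult_right[OF has_bochner_integral_max_exp_density[OF elim]]])
      also have "(\<lambda>x. 1 / w (ln (real n)) * (B (ln (real n) + x) * max_exp_density n x) - g (ln (real n)) * max_exp_density n x)
          = (\<lambda>x. h n x * max_exp_density n x)"
        by (simp add: h_def fun_eq_iff left_diff_distrib)
      finally show ?case
        by (simp add: has_bochner_integral_integral_eq)
    qed
  qed
qed

section \<open>The entire part of the exponential of a square root\<close>

text \<open>The sum is, up to sign, the \<open>n\<close>-th finite difference of a polynomial of degree less than \<open>n\<close>. The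
induction uses $k \binom nk = n \binom{n-1}{k-1}$, which lowers the order of the difference and the
degree by one each.\<close>
lemma alternating_binomial_sum_power_eq_0:
  assumes "j < n"
  shows "(\<Sum>k\<le>n. real (n choose k) * (-1) ^ k * real k ^ j) = 0"
  using assms
proof (induction j arbitrary: n rule: less_induct)
  case (less j)
  obtain m where n: "n = Suc m" using less.prems by (cases n) auto
  show ?case
  proof (cases j)
    case 0
    then show ?thesis using choose_alternating_sum[of n, where 'a = real] n by (simp add: mult.commute)
  next
    case (Suc i)
    have "(\<Sum>k\<le>n. real (n choose k) * (-1) ^ k * real k ^ j)
        = (\<Sum>k\<le>m. real (n choose Suc k) * (-1) ^ Suc k * real (Suc k) ^ j)"
      unfolding n Suc by (subst sum.atMost_Suc_shift) simp
    also have "\<dots> = (\<Sum>k\<le>m. - real n * (real (m choose k) * (-1) ^ k * (\<Sum>r\<le>i. real (i choose r) * real k ^ r)))"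
    proof (rule sum.cong[OF refl])
      fix k
      have 1: "real (Suc k) * real (n choose Suc k) = real n * real (m choose k)"
        unfolding n of_nat_mult[symmetric] by (simp only: Suc_times_binomial_eq mult.commute)
      have 2: "real (Suc k) ^ i = (\<Sum>r\<le>i. real (i choose r) * real k ^ r)"
        using binomial_ring[of "real k" 1 i] by (simp add: add.commute)
      have "real (n choose Suc k) * (-1) ^ Suc k * real (Suc k) ^ j
          = (real (Suc k) * real (n choose Suc k)) * (-1) ^ Suc k * real (Suc k) ^ i"
        unfolding Suc by simp
      then show "real (n choose Suc k) * (-1) ^ Suc k * real (Suc k) ^ j
          = - real n * (real (m choose k) * (-1) ^ k * (\<Sum>r\<le>i. real (i choose r) * real k ^ r))"
        unfolding 1 2 by simp
    qed
    also have "\<dots> = - real n * (\<Sum>k\<le>m. \<Sum>r\<le>i. real (i choose r) * (real (m choose k) * (-1) ^ k * real k ^ r))"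
      unfolding sum_distrib_left by (intro sum.cong refl) (simp add: mult_ac)
    also have "(\<Sum>k\<le>m. \<Sum>r\<le>i. real (i choose r) * (real (m choose k) * (-1) ^ k * real k ^ r))
        = (\<Sum>r\<le>i. real (i choose r) * (\<Sum>k\<le>m. real (m choose k) * (-1) ^ k * real k ^ r))"
      by (subst sum.swap) (simp add: sum_distrib_left)
    also have "\<dots> = 0"
      using less.prems Suc n by (intro sum.neutral ballI) (simp add: less.IH)
    finally show ?thesis by simp
  qed
qed

lemma fact_mult_power_le_fact_add: "fact j * j ^ i \<le> (fact (j + i) :: nat)"
proof (induction i)
  case (Suc i)
  have "fact j * j ^ Suc i = (fact j * j ^ i) * j" by simp
  also have "\<dots> \<le> fact (j + i) * (j + Suc i)" by (intro mult_mono Suc.IH) auto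
  finally show ?case by (simp add: mult.commute)
qed simp

text \<open>The coefficients $1/(2j)!$ show that $\cosh\sqrt x$ is entire of order $1/2$ in $x$; this smallness is what makes its
finite differences negligible.\<close>
lemma cosh_sqrt_sums:
  fixes x :: real assumes "x \<ge> 0"
  shows "(\<lambda>j. x ^ j / fact (2 * j)) sums cosh (sqrt x)"
proof -
  have "(\<lambda>j. (\<lambda>n. if even n then sqrt x ^ n /\<^sub>R fact n else 0) (2 * j)) sums cosh (sqrt x)"
    using cosh_converges[of "sqrt x"]
    by (subst sums_mono_reindex) (auto simp: strict_mono_def)
  moreover have "sqrt x ^ (2 * j) = x ^ j" for j using assms by (simp add: power_mult)
  ultimately show ?thesis by (simp add: divide_inverse mult_ac)
qed

text \<open>Only the powers $k^j$ with $j \ge n$ contribute. For those, the crude bound $2^n n^j$ on the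
alternating sum is beaten by $(2j)! \ge j!\, j^j \ge j!\, n^j$, and $2^n \le 4^j / 2^n$ makes the
remaining series a multiple of that of $e^4$.\<close>
lemma alternating_binomial_sum_cosh_sqrt_bound:
  "\<bar>\<Sum>k\<le>n. real (n choose k) * (-1) ^ k * cosh (sqrt (real k))\<bar> \<le> exp 4 / 2 ^ n"
proof -
  define a where "a j = (\<Sum>k\<le>n. real (n choose k) * (-1) ^ k * real k ^ j) / fact (2 * j)" for j
  have a_sums: "a sums (\<Sum>k\<le>n. real (n choose k) * (-1) ^ k * cosh (sqrt (real k)))"
  proof -
    have "(\<lambda>j. \<Sum>k\<le>n. real (n choose k) * (-1) ^ k * (real k ^ j / fact (2 * j)))
        sums (\<Sum>k\<le>n. real (n choose k) * (-1) ^ k * cosh (sqrt (real k)))"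
      by (intro sums_sum sums_mult cosh_sqrt_sums) auto
    then show ?thesis unfolding a_def by (simp add: sum_divide_distrib)
  qed
  have a_le: "\<bar>a j\<bar> \<le> (4 ^ j / fact j) / 2 ^ n" for j
  proof (cases "j < n")
    case True
    then show ?thesis by (simp add: a_def alternating_binomial_sum_power_eq_0)
  next
    case False
    have "\<bar>\<Sum>k\<le>n. real (n choose k) * (-1) ^ k * real k ^ j\<bar> \<le> (\<Sum>k\<le>n. real (n choose k) * real n ^ j)"
      by (rule order_trans[OF sum_abs]) (auto intro!: sum_mono mult_left_mono power_mono simp: abs_mult)
    also have "\<dots> = 2 ^ n * real n ^ j"
      unfolding sum_distrib_right[symmetric] of_nat_sum[symmetric] choose_row_sum by simp
    also have "\<dots> \<le> 2 ^ n * real j ^ j" using False by (intro mult_left_mono power_mono) auto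
    finally have 1: "\<bar>\<Sum>k\<le>n. real (n choose k) * (-1) ^ k * real k ^ j\<bar> \<le> 2 ^ n * real j ^ j" .
    have "real (fact j * j ^ j) \<le> real (fact (j + j))"
      by (rule of_nat_mono[OF fact_mult_power_le_fact_add])
    then have 2: "fact j * real j ^ j \<le> fact (2 * j)" by (simp add: mult_2)
    have 3: "(2::real) ^ n * 2 ^ n \<le> 4 ^ j"
    proof -
      have "(2::real) ^ n * 2 ^ n = 4 ^ n" by (simp add: power_mult_distrib[symmetric])
      also have "\<dots> \<le> 4 ^ j" using False by (intro power_increasing) auto
      finally show ?thesis .
    qed
    have "\<bar>a j\<bar> \<le> 2 ^ n * real j ^ j / fact (2 * j)"
      unfolding a_def abs_divide using 1 by (simp add: divide_right_mono)
    also have "\<dots> \<le> 2 ^ n / fact j"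
      using 2 by (simp add: field_simps)
    also have "\<dots> \<le> (4 ^ j / fact j) / 2 ^ n"
      using 3 by (simp add: field_simps)
    finally show ?thesis .
  qed
  have e: "(\<lambda>j. (4 ^ j / fact j) / 2 ^ n) sums (exp (4::real) / 2 ^ n)"
    using sums_divide[OF exp_converges[of "4::real"], of "2 ^ n"] by (simp add: divide_inverse mult_ac)
  show ?thesis
    unfolding abs_le_iff
    using sums_le[OF _ a_sums e] sums_le[OF _ sums_minus[OF a_sums] e] a_le by (simp add: abs_le_iff)
qed

section \<open>The error function and the decaying exponential of a square root\<close>

definition erf :: "real \<Rightarrow> real" where
  "erf x = 2 / sqrt pi * (LBINT s=0..ereal x. exp (- s\<^sup>2))"

lemma erf_0 [simp]: "erf 0 = 0"
  by (simp add: erf_def zero_ereal_def)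

lemma erf_has_real_derivative:
  "(erf has_real_derivative 2 / sqrt pi * exp (- x\<^sup>2)) (at x)"
proof -
  define c where "c = \<bar>x\<bar> + 1"
  have "((\<lambda>u. LBINT s=ereal 0..ereal u. exp (- s\<^sup>2)) has_vector_derivative exp (- x\<^sup>2)) (at x within {-c..c})"
    by (rule interval_integral_FTC2) (auto simp: c_def intro!: continuous_intros)
  then have "((\<lambda>u. LBINT s=0..ereal u. exp (- s\<^sup>2)) has_vector_derivative exp (- x\<^sup>2)) (at x)"
    unfolding zero_ereal_def[symmetric] by (subst (asm) at_within_interior) (auto simp: c_def)
  then show ?thesis
    unfolding erf_def[abs_def]
    by (intro DERIV_cmult) (simp add: has_real_derivative_iff_has_vector_derivative)
qed

lemmas erf_has_real_derivative' [derivative_intros] = DERIV_chain2[OF erf_has_real_derivative]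

lemma isCont_erf: "isCont erf x"
  by (rule DERIV_isCont[OF erf_has_real_derivative])

lemma erf_measurable [measurable]: "erf \<in> borel_measurable borel"
  by (intro borel_measurable_continuous_onI continuous_at_imp_continuous_on ballI isCont_erf)

text \<open>Oddness is used to read off the limit at $-\infty$ from the one at $\infty$.\<close>
lemma erf_minus: "erf (- x) = - erf x"
proof -
  have "((\<lambda>y. erf y + erf (- y)) has_real_derivative 0) (at y)" for y
    by (auto intro!: derivative_eq_intros)
  then have "erf x + erf (- x) = erf 0 + erf (- 0)"
    by (intro DERIV_isconst_all allI)
  then show ?thesis by simp
qed

lemma erf_tendsto_at_top: "(erf \<longlongrightarrow> 1) at_top"
proof -
  let ?f = "\<lambda>x::real. indicator {0..} x *\<^sub>R exp (- x\<^sup>2)"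
  have "((\<lambda>y. \<integral>x. indicator {..y} x *\<^sub>R ?f x \<partial>lborel) \<longlongrightarrow> (\<integral>x. ?f x \<partial>lborel)) at_top"
    using gaussian_moment_0 by (intro tendsto_integral_at_top) (auto simp: has_bochner_integral_iff)
  also have "(\<integral>x. ?f x \<partial>lborel) = sqrt pi / 2"
    using gaussian_moment_0 by (simp add: has_bochner_integral_iff)
  finally have "((\<lambda>y. 2 / sqrt pi * (\<integral>x. indicator {..y} x *\<^sub>R ?f x \<partial>lborel)) \<longlongrightarrow> 2 / sqrt pi * (sqrt pi / 2)) at_top"
    by (rule tendsto_mult_left)
  also have "2 / sqrt pi * (sqrt pi / 2) = 1" by simp
  finally show ?thesis
  proof (rule Lim_transform_eventually)
    show "eventually (\<lambda>y. 2 / sqrt pi * (\<integral>x. indicator {..y} x *\<^sub>R ?f x \<partial>lborel) = erf y) at_top"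
      using eventually_ge_at_top[of 0]
    proof eventually_elim
      case (elim y)
      have "(LBINT s=0..ereal y. exp (- s\<^sup>2)) = (\<integral>x. indicator {..y} x *\<^sub>R ?f x \<partial>lborel)"
        using elim unfolding zero_ereal_def interval_integral_Icc[OF elim] set_lebesgue_integral_def
        by (intro Bochner_Integration.integral_cong) (auto split: split_indicator)
      then show ?case by (simp add: erf_def)
    qed
  qed
qed

lemma erf_tendsto_at_bot: "(erf \<longlongrightarrow> -1) at_bot"
proof -
  have "((\<lambda>x. - erf x) \<longlongrightarrow> -1) at_top" by (intro tendsto_minus erf_tendsto_at_top)
  then show ?thesis unfolding filterlim_at_bot_mirror by (simp add: erf_minus)
qed

lemma erf_mono: "x \<le> y \<Longrightarrow> erf x \<le> erf y"
  by (erule DERIV_nonneg_imp_nondecreasing) (use erf_has_real_derivative in force)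

lemma erf_nonneg: "x \<ge> 0 \<Longrightarrow> erf x \<ge> 0"
  using erf_mono[of 0 x] by simp

lemma erf_le_1: "erf x \<le> 1"
  by (rule tendsto_lowerbound[OF erf_tendsto_at_top])
     (auto intro!: eventually_mono[OF eventually_ge_at_top[of x]] erf_mono)

lemma erf_le_linear:
  assumes "x \<ge> 0" shows "erf x \<le> 2 / sqrt pi * x"
proof -
  have "erf x - 2 / sqrt pi * x \<le> erf 0 - 2 / sqrt pi * 0"
  proof (rule DERIV_nonpos_imp_nonincreasing[OF assms])
    fix y :: real
    have "((\<lambda>x. erf x - 2 / sqrt pi * x) has_real_derivative 2 / sqrt pi * (exp (- y\<^sup>2) - 1)) (at y)"
      
      using DERIV_diff[OF erf_has_real_derivative[of y] DERIV_cmult[OF DERIV_ident, of "2 / sqrt pi"]]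
      by (simp only: right_diff_distrib mult_1_right)
    moreover have "2 / sqrt pi * (exp (- y\<^sup>2) - 1) \<le> 0" by (intro mult_nonneg_nonpos) auto
    ultimately show "\<exists>d. ((\<lambda>x. erf x - 2 / sqrt pi * x) has_real_derivative d) (at y) \<and> d \<le> 0" by blast
  qed
  then show ?thesis by simp
qed

text \<open>The Laplace transform of $\mathrm{erf}(1/(2\sqrt t))$. The integrand has an elementary
antiderivative in terms of the error function: integration by parts leaves
$t^{-3/2} e^{-kt - 1/(4t)}$, and the exponent is minus either of the squares
$(\sqrt{kt} \pm 1/(2\sqrt t))^2$ up to the additive constants $\pm\sqrt k$.\<close>
lemma has_bochner_integral_erf_laplace:
  assumes k: "k > 0"
  shows "has_bochner_integral lborel
           (\<lambda>t. indicator {0<..} t * (erf (1 / (2 * sqrt t)) * exp (- (k * t)))) ((1 - exp (- sqrt k)) / k)"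
proof -
  define a where "a = sqrt k"
  have a: "a > 0" "k = a\<^sup>2" using k by (auto simp: a_def)
  define F where "F t = - exp (- (k * t)) * erf (1 / (2 * sqrt t))
      - (exp (-a) * erf (a * sqrt t - 1 / (2 * sqrt t)) - exp a * erf (a * sqrt t + 1 / (2 * sqrt t))) / 2" for t
  define f where "f t = k * (erf (1 / (2 * sqrt t)) * exp (- (k * t)))" for t
  have deriv: "(F has_real_derivative f t) (at t)" if t: "t > 0" for t
  proof -
    define s where "s = sqrt t"
    have s: "s > 0" "t = s\<^sup>2" using t by (auto simp: s_def)
    define y' where "y' = - 1 / (4 * s ^ 3)"
    have y: "((\<lambda>t. 1 / (2 * sqrt t)) has_real_derivative y') (at t)"
      using t s(1) by (auto intro!: derivative_eq_intros simp: y'_def s_def[symmetric] field_simps power3_eq_cube power2_eq_square)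
    define d where "d = a / (2 * s)"
    have v: "((\<lambda>t. a * sqrt t) has_real_derivative d) (at t)"
      unfolding d_def using t by (auto intro!: derivative_eq_intros simp: s_def[symmetric] field_simps)
    \<comment> \<open>Completing the square: this is where the factors \<open>exp (- a)\<close> and \<open>exp a\<close> in \<open>F\<close> come from.\<close>
    have e1: "exp (-a) * exp (- (a * s - 1 / (2 * s))\<^sup>2) = exp (- (k * t)) * exp (- (1 / (2 * s))\<^sup>2)"
      unfolding exp_add[symmetric] a(2) s(2) using s(1) by (simp add: field_simps power2_eq_square)
    have e2: "exp a * exp (- (a * s + 1 / (2 * s))\<^sup>2) = exp (- (k * t)) * exp (- (1 / (2 * s))\<^sup>2)"
      unfolding exp_add[symmetric] a(2) s(2) using s(1) by (simp add: field_simps power2_eq_square)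
    have ek: "((\<lambda>t. - exp (- (k * t))) has_real_derivative k * exp (- (k * t))) (at t)"
      by (auto intro!: derivative_eq_intros)
    note erf_chain = DERIV_chain2[OF erf_has_real_derivative]
    have "(F has_real_derivative
       (k * exp (- (k * t)) * erf (1 / (2 * sqrt t))
          + 2 / sqrt pi * exp (- (1 / (2 * sqrt t))\<^sup>2) * y' * - exp (- (k * t)))
       - (exp (-a) * (2 / sqrt pi * exp (- (a * sqrt t - 1 / (2 * sqrt t))\<^sup>2) * (d - y'))
          - exp a * (2 / sqrt pi * exp (- (a * sqrt t + 1 / (2 * sqrt t))\<^sup>2) * (d + y'))) / 2) (at t)"
      unfolding F_def[abs_def]
      by (intro DERIV_diff DERIV_mult DERIV_cdivide DERIV_cmult ek erf_chain[OF y]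
                erf_chain[OF DERIV_diff[OF v y]] erf_chain[OF DERIV_add[OF v y]])
    also have "(k * exp (- (k * t)) * erf (1 / (2 * sqrt t))
          + 2 / sqrt pi * exp (- (1 / (2 * sqrt t))\<^sup>2) * y' * - exp (- (k * t)))
       - (exp (-a) * (2 / sqrt pi * exp (- (a * sqrt t - 1 / (2 * sqrt t))\<^sup>2) * (d - y'))
          - exp a * (2 / sqrt pi * exp (- (a * sqrt t + 1 / (2 * sqrt t))\<^sup>2) * (d + y'))) / 2
       = k * exp (- (k * t)) * erf (1 / (2 * s)) - 2 / sqrt pi * (exp (- (k * t)) * exp (- (1 / (2 * s))\<^sup>2)) * y'
         - ((exp (-a) * exp (- (a * s - 1 / (2 * s))\<^sup>2)) * (2 / sqrt pi * (d - y'))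
            - (exp a * exp (- (a * s + 1 / (2 * s))\<^sup>2)) * (2 / sqrt pi * (d + y'))) / 2"
      by (simp add: s_def[symmetric] field_simps)
    also have "\<dots> = f t"
      unfolding e1 e2 f_def s_def[symmetric] by (simp add: field_simps)
    finally show ?thesis .
  qed
  have F_top: "(F \<longlongrightarrow> - (exp (-a) - exp a) / 2) at_top"
  proof -
    have "((\<lambda>t. exp (- (k * t))) \<longlongrightarrow> 0) at_top" using k by real_asymp
    moreover have "((\<lambda>t. erf (1 / (2 * sqrt t))) \<longlongrightarrow> erf 0) at_top"
      by (intro isCont_tendsto_compose[OF isCont_erf]) real_asymp
    moreover have "((\<lambda>t. erf (a * sqrt t - 1 / (2 * sqrt t))) \<longlongrightarrow> 1) at_top"
                  "((\<lambda>t. erf (a * sqrt t + 1 / (2 * sqrt t))) \<longlongrightarrow> 1) at_top"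
      using a(1) by (intro filterlim_compose[OF erf_tendsto_at_top]; real_asymp)+
    ultimately have "(F \<longlongrightarrow> - 0 * erf 0 - (exp (-a) * 1 - exp a * 1) / 2) at_top"
      unfolding F_def[abs_def] by (intro tendsto_intros) auto
    also have "- 0 * erf 0 - (exp (-a) * 1 - exp a * 1) / 2 = - (exp (-a) - exp a) / 2"
      by (simp add: field_simps)
    finally show ?thesis .
  qed
  have F_0: "(F \<longlongrightarrow> -1 + (exp (-a) + exp a) / 2) (at_right 0)"
  proof -
    have "((\<lambda>t. exp (- (k * t))) \<longlongrightarrow> 1) (at_right 0)" by real_asymp
    moreover have "((\<lambda>t. erf (1 / (2 * sqrt t))) \<longlongrightarrow> 1) (at_right 0)"
                  "((\<lambda>t. erf (a * sqrt t + 1 / (2 * sqrt t))) \<longlongrightarrow> 1) (at_right 0)"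
      using a(1) by (intro filterlim_compose[OF erf_tendsto_at_top]; real_asymp)+
    moreover have "((\<lambda>t. erf (a * sqrt t - 1 / (2 * sqrt t))) \<longlongrightarrow> -1) (at_right 0)"
      using a(1) by (intro filterlim_compose[OF erf_tendsto_at_bot]; real_asymp)
    ultimately have "(F \<longlongrightarrow> - 1 * 1 - (exp (-a) * (-1) - exp a * 1) / 2) (at_right 0)"
      unfolding F_def[abs_def] by (intro tendsto_intros) auto
    also have "- 1 * 1 - (exp (-a) * (-1) - exp a * 1) / 2 = -1 + (exp (-a) + exp a) / 2"
      by (simp add: field_simps)
    finally show ?thesis .
  qed
  have cont: "isCont f t" if "t > 0" for t
    unfolding f_def using that by (intro continuous_intros isCont_o2[OF _ isCont_erf]) auto
  have nonneg: "f t \<ge> 0" if "t > 0" for t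
    unfolding f_def using that k by (intro mult_nonneg_nonneg erf_nonneg) auto
  have int: "set_integrable lborel (einterval 0 \<infinity>) f" 
    and val: "(LBINT t=0..\<infinity>. f t) = - (exp (-a) - exp a) / 2 - (-1 + (exp (-a) + exp a) / 2)"
    using interval_integral_FTC_nonneg[of 0 \<infinity> F f "-1 + (exp (-a) + exp a) / 2" "- (exp (-a) - exp a) / 2"]
      deriv cont nonneg F_top F_0
    by (auto simp: ereal_tendsto_simps zero_ereal_def)
  have "set_integrable lborel {0<..} f" using int by (simp add: zero_ereal_def)
  moreover have "(LBINT t:{0<..}. f t) = 1 - exp (- a)"
    using val unfolding interval_lebesgue_integral_0_infty by (simp add: diff_divide_distrib add_divide_distrib)
  ultimately have "has_bochner_integral lborel (\<lambda>t. indicator {0<..} t * f t) (1 - exp (- a))"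
    by (simp add: has_bochner_integral_iff set_integrable_def set_lebesgue_integral_def)
  from has_bochner_integral_mult_right[OF this, of "1 / k"]
  show ?thesis using k by (simp add: f_def a_def mult_ac)
qed

text \<open>For large $t$ the linear bound on the error function gives the decay, for small $t$ the bound by 1
suffices; adding the squares of the two estimates covers both cases at once.\<close>
lemma erf_bound:
  assumes "t > 0"
  shows "\<bar>erf (1 / (2 * sqrt t))\<bar> \<le> 2 * (1 + t) powr (- (1 / 2))"
proof -
  define y where "y = erf (1 / (2 * sqrt t))"
  have y0: "y \<ge> 0" unfolding y_def using assms by (intro erf_nonneg) auto
  have y1: "y \<le> 1" unfolding y_def by (rule erf_le_1)
  have "y \<le> 2 / sqrt pi * (1 / (2 * sqrt t))" unfolding y_def using assms by (intro erf_le_linear) auto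
  also have "\<dots> = (1 / sqrt pi) * (1 / sqrt t)" by simp
  also have "\<dots> \<le> 1 * (1 / sqrt t)" using pi_gt3 assms by (intro mult_right_mono) auto
  finally have "y * sqrt t \<le> 1" using assms by (simp add: field_simps)
  then have "(y * sqrt t)\<^sup>2 \<le> 1\<^sup>2" using y0 assms by (intro power_mono) auto
  moreover have "y\<^sup>2 \<le> 1\<^sup>2" using y0 y1 by (intro power_mono) auto
  ultimately have "(y * sqrt (1 + t))\<^sup>2 \<le> 2\<^sup>2"
    using assms by (simp add: power_mult_distrib algebra_simps)
  then have "y * sqrt (1 + t) \<le> 2" by (rule power2_le_imp_le) simp
  then have "\<bar>y\<bar> \<le> 2 * (1 + t) powr (- (1 / 2))"
    using y0 assms by (simp add: powr_minus powr_half_sqrt field_simps)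
  then show ?thesis unfolding y_def .
qed

text \<open>The argument $1/(2\sqrt t)$ tends to 0, so that only the derivative of the error function at 0 matters.\<close>
lemma erf_asymptotic:
  "((\<lambda>t. erf (1 / (2 * sqrt t)) / (1 + t) powr (- (1 / 2)) - 1 / sqrt pi) \<longlongrightarrow> 0) at_top"
proof -
  have "((\<lambda>h. (erf (0 + h) - erf 0) / h) \<longlongrightarrow> 2 / sqrt pi * exp (- 0\<^sup>2)) (at 0)"
    using erf_has_real_derivative[of 0] unfolding DERIV_def .
  then have 1: "((\<lambda>h. erf h / h) \<longlongrightarrow> 2 / sqrt pi) (at_right 0)"
    by (auto intro: tendsto_mono[OF at_le])
  have 2: "filterlim (\<lambda>t::real. 1 / (2 * sqrt t)) (at_right 0) at_top" by real_asymp
  have 3: "((\<lambda>t::real. (1 / (2 * sqrt t)) / (1 + t) powr (- (1 / 2))) \<longlongrightarrow> 1 / 2) at_top" by real_asymp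
  from tendsto_mult[OF filterlim_compose[OF 1 2] 3]
  have "((\<lambda>t. erf (1 / (2 * sqrt t)) / (1 / (2 * sqrt t)) * ((1 / (2 * sqrt t)) / (1 + t) powr (- (1 / 2)))) \<longlongrightarrow> 1 / sqrt pi) at_top"
    by simp
  then have "((\<lambda>t. erf (1 / (2 * sqrt t)) / (1 + t) powr (- (1 / 2))) \<longlongrightarrow> 1 / sqrt pi) at_top"
    by (rule Lim_transform_eventually) (auto intro!: eventually_mono[OF eventually_gt_at_top[of 0]])
  then show ?thesis by (simp add: LIM_zero)
qed

section \<open>The Bessel functions as inverse Laplace transforms\<close>

text \<open>The Bessel-Clifford function of order 0. For $t \ge 0$ its values at $t$ and $-t$ are
$I_0(2\sqrt t)$ and $J_0(2\sqrt t)$. Treating both as one entire function makes the algebra uniform in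
the sign.\<close>
definition bessel_clifford :: "real \<Rightarrow> real" where
  "bessel_clifford x = (\<Sum>m. x ^ m / (fact m)\<^sup>2)"

lemma summable_bessel_clifford_abs: "summable (\<lambda>m. \<bar>x\<bar> ^ m / (fact m)\<^sup>2 :: real)"
proof (rule summable_comparison_test')
  show "summable (\<lambda>m. \<bar>x\<bar> ^ m / fact m)"
    using exp_converges[of "\<bar>x\<bar>"] by (simp add: sums_iff divide_inverse mult_ac)
  show "norm (\<bar>x\<bar> ^ m / (fact m)\<^sup>2) \<le> \<bar>x\<bar> ^ m / fact m" for m
    using self_le_power[of "fact m :: real" 2] by (auto intro!: divide_left_mono simp: fact_ge_1)
qed

lemma summable_bessel_clifford: "summable (\<lambda>m. x ^ m / (fact m)\<^sup>2 :: real)"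
  by (rule summable_norm_cancel) (use summable_bessel_clifford_abs[of x] in \<open>simp add: power_abs\<close>)

lemma isCont_bessel_clifford: "isCont bessel_clifford x"
proof -
  have "summable (\<lambda>m. 1 / (fact m)\<^sup>2 * y ^ m :: real)" for y
    using summable_bessel_clifford[of y] by simp
  from isCont_powser_converges_everywhere[OF this, of x] show ?thesis
    unfolding bessel_clifford_def[abs_def] by simp
qed

lemma bessel_clifford_measurable [measurable]: "bessel_clifford \<in> borel_measurable borel"
  by (intro borel_measurable_continuous_onI continuous_at_imp_continuous_on ballI isCont_bessel_clifford)

text \<open>Term by term, $\int_0^\infty t^m e^{-kt}\, dt = m!/k^{m+1}$ cancels one of the two factorials and leaves
the exponential series of $c/k$. Absolute convergence, by the same computation with $|c|$, justifies the
exchange of sum and integral.\<close>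
lemma has_bochner_integral_bessel_clifford_laplace:
  fixes c k :: real
  assumes k: "k > 0"
  shows "has_bochner_integral lborel
           (\<lambda>t. indicator {0<..} t * (bessel_clifford (c * t) * exp (- (k * t)))) (exp (c / k) / k)"
proof -
  define f where "f m t = c ^ m / (fact m)\<^sup>2 * (indicator {0<..} t * (t ^ m * exp (- (k * t))))" for m and t :: real
  have f: "has_bochner_integral lborel (f m) ((c / k) ^ m / fact m / k)" for m
  proof -
    have "c ^ m / (fact m)\<^sup>2 * (fact m / k ^ Suc m) = (c / k) ^ m / fact m / k"
      by (simp add: power_divide field_simps power2_eq_square)
    then show ?thesis
      unfolding f_def[abs_def] 
      using has_bochner_integral_mult_right[OF has_bochner_integral_power_exp_scaled[OF k, of m], of "c ^ m / (fact m)\<^sup>2"]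
      by simp
  qed
  have norm_f: "has_bochner_integral lborel (\<lambda>t. norm (f m t)) ((\<bar>c\<bar> / k) ^ m / fact m / k)" for m
  proof -
    have 1: "norm (f m t) = \<bar>c\<bar> ^ m / (fact m)\<^sup>2 * (indicator {0<..} t * (t ^ m * exp (- (k * t))))" for t
      unfolding f_def by (simp add: abs_mult power_abs split: split_indicator)
    have "\<bar>c\<bar> ^ m / (fact m)\<^sup>2 * (fact m / k ^ Suc m) = (\<bar>c\<bar> / k) ^ m / fact m / k"
      by (simp add: power_divide field_simps power2_eq_square)
    then show ?thesis
      unfolding 1
      using has_bochner_integral_mult_right[OF has_bochner_integral_power_exp_scaled[OF k, of m], of "\<bar>c\<bar> ^ m / (fact m)\<^sup>2"]
      by simp
  qed
  have pointwise: "(\<lambda>m. f m t) sums (indicator {0<..} t * (bessel_clifford (c * t) * exp (- (k * t))))" for t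
  proof -
    have "(\<lambda>m. (c * t) ^ m / (fact m)\<^sup>2) sums bessel_clifford (c * t)"
      unfolding bessel_clifford_def by (rule summable_sums[OF summable_bessel_clifford])
    from sums_mult[OF this, of "indicator {0<..} t * exp (- (k * t))"] show ?thesis
      by (simp add: f_def power_mult_distrib mult_ac)
  qed
  have exp_sums: "(\<lambda>m. (y / k) ^ m / fact m / k) sums (exp (y / k) / k)" for y
    using sums_divide[OF exp_converges[of "y / k"], of k] by (simp add: divide_inverse mult_ac)
  have summable_norm: "summable (\<lambda>m. norm (f m t))" for t
  proof -
    have "norm (f m t) = \<bar>c * t\<bar> ^ m / (fact m)\<^sup>2 * (indicator {0<..} t * exp (- (k * t)))" for m
      unfolding f_def by (simp add: abs_mult power_abs power_mult_distrib split: split_indicator)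
    then show ?thesis
      using summable_mult2[OF summable_bessel_clifford_abs[of "c * t"]] by simp
  qed
  have int: "integrable lborel (f m)" for m using f[of m] by (simp add: has_bochner_integral_iff)
  have summ: "summable (\<lambda>m. \<integral>t. norm (f m t) \<partial>lborel)"
    using norm_f exp_sums[of "\<bar>c\<bar>"] by (simp add: has_bochner_integral_iff sums_iff)
  have AE: "AE t in lborel. summable (\<lambda>m. norm (f m t))" using summable_norm by simp
  have "(\<integral>t. (\<Sum>m. f m t) \<partial>lborel) = (\<Sum>m. \<integral>t. f m t \<partial>lborel)"
    by (rule integral_suminf[OF int AE summ])
  also have "\<dots> = exp (c / k) / k"
    using f exp_sums[of c] by (simp add: has_bochner_integral_iff sums_iff)
  finally have "has_bochner_integral lborel (\<lambda>t. \<Sum>m. f m t) (exp (c / k) / k)"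
    using integrable_suminf[OF int AE summ] by (simp add: has_bochner_integral_iff)
  then show ?thesis using pointwise by (simp add: sums_iff)
qed

text \<open>Wallis' integrals. The recursion in \<open>m\<close> comes from integrating the derivative of
$\sin\theta \cos^{2m+1}\theta$, which vanishes at both ends.\<close>
lemma has_bochner_integral_cos_even_power:
  "has_bochner_integral lborel (\<lambda>\<theta>. indicator {0..pi/2} \<theta> * cos \<theta> ^ (2 * m))
     (pi / 2 * (fact (2 * m) / (4 ^ m * (fact m)\<^sup>2)))"
proof (induction m)
  case 0
  have "has_bochner_integral lborel (\<lambda>\<theta>::real. indicator {0..pi/2} \<theta> :: real) (pi / 2)"
    using has_bochner_integral_real_indicator[of "{0..pi/2}" lborel] by simp
  then show ?case by simp
next
  case (Suc m)
  define I where "I = pi / 2 * (fact (2 * m) / (4 ^ m * (fact m)\<^sup>2))"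
  have "has_bochner_integral lborel
     (\<lambda>\<theta>. (real (2 * m + 2) * cos \<theta> ^ (2 * m + 2) - real (2 * m + 1) * cos \<theta> ^ (2 * m)) * indicator {0..pi/2} \<theta>)
     (sin (pi/2) * cos (pi/2) ^ (2 * m + 1) - sin 0 * cos 0 ^ (2 * m + 1))"
  proof (rule has_bochner_integral_FTC_Icc_real)
    fix x :: real
    have "((\<lambda>\<theta>. sin \<theta> * cos \<theta> ^ (2 * m + 1)) has_real_derivative
       cos x * cos x ^ (2 * m + 1) - (sin x)\<^sup>2 * (real (2 * m + 1) * cos x ^ (2 * m))) (at x)"
      by (rule derivative_eq_intros refl | simp add: power2_eq_square algebra_simps)+
    also have "cos x * cos x ^ (2 * m + 1) - (sin x)\<^sup>2 * (real (2 * m + 1) * cos x ^ (2 * m)) =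
       real (2 * m + 2) * cos x ^ (2 * m + 2) - real (2 * m + 1) * cos x ^ (2 * m)"
      unfolding sin_squared_eq by (simp add: algebra_simps power2_eq_square)
    finally show "((\<lambda>\<theta>. sin \<theta> * cos \<theta> ^ (2 * m + 1)) has_real_derivative
       real (2 * m + 2) * cos x ^ (2 * m + 2) - real (2 * m + 1) * cos x ^ (2 * m)) (at x)" .
  qed (auto intro!: continuous_intros)
  then have "has_bochner_integral lborel
     (\<lambda>\<theta>. (real (2 * m + 2) * cos \<theta> ^ (2 * m + 2) - real (2 * m + 1) * cos \<theta> ^ (2 * m)) * indicator {0..pi/2} \<theta>) 0"
    by simp
  from has_bochner_integral_add[OF this has_bochner_integral_mult_right[OF Suc.IH, of "real (2 * m + 1)"]]
  have "has_bochner_integral lborel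
     (\<lambda>\<theta>. real (2 * m + 2) * (indicator {0..pi/2} \<theta> * cos \<theta> ^ (2 * Suc m))) (real (2 * m + 1) * I)"
    unfolding I_def by (simp add: algebra_simps)
  moreover have "1 / real (2 * m + 2) * (real (2 * m + 2) * y) = y" for y by simp
  ultimately  have "has_bochner_integral lborel (\<lambda>\<theta>. indicator {0..pi/2} \<theta> * cos \<theta> ^ (2 * Suc m))
          (1 / real (2 * m + 2) * (real (2 * m + 1) * I))"
    using has_bochner_integral_mult_right[of "1 / real (2 * m + 2)" lborel] by fastforce
  also have "1 / real (2 * m + 2) * (real (2 * m + 1) * I)
     = pi / 2 * (fact (2 * Suc m) / (4 ^ Suc m * (fact (Suc m))\<^sup>2))"
  proof -
    have "fact (2 * Suc m) = (real (2 * m + 2) * real (2 * m + 1)) * fact (2 * m)"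
      by (simp add: algebra_simps)
    moreover have "4 ^ Suc m * (fact (Suc m))\<^sup>2 = (real (2 * m + 2) * real (2 * m + 2)) * (4 ^ m * (fact m)\<^sup>2)"
      by (simp add: algebra_simps power2_eq_square)
    ultimately show ?thesis unfolding I_def by (simp add: divide_simps del: of_nat_add of_nat_mult fact_Suc power_Suc)
  qed
  finally show ?case .
qed

text \<open>Multiplying $(4x\cos^2\theta)^m/(2m)!$ by the Wallis integral turns $(2m)!$ into $4^m (m!)^2$. The
function \<open>E\<close> is the sum of this series, so that the hyperbolic and the trigonometric case share one
proof.\<close>
lemma has_bochner_integral_bessel_clifford:
  assumes E: "\<And>\<theta>. (\<lambda>m. (4 * x * (cos \<theta>)\<^sup>2) ^ m / fact (2 * m)) sums E \<theta>"
  shows "has_bochner_integral lborel (\<lambda>\<theta>. indicator {0..pi/2} \<theta> * E \<theta>) (pi / 2 * bessel_clifford x)"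
proof -
  define f where "f m \<theta> = (4 * x) ^ m / fact (2 * m) * (indicator {0..pi/2} \<theta> * cos \<theta> ^ (2 * m))" for m \<theta>
  have scale: "(4 * y) ^ m / fact (2 * m) * (pi / 2 * (fact (2 * m) / (4 ^ m * (fact m)\<^sup>2)))
                 = pi / 2 * (y ^ m / (fact m)\<^sup>2)" for y :: real and m
    by (simp add: power_mult_distrib)
  have f: "has_bochner_integral lborel (f m) (pi / 2 * (x ^ m / (fact m)\<^sup>2))" for m
    unfolding f_def[abs_def] scale[symmetric]
    by (rule has_bochner_integral_mult_right[OF has_bochner_integral_cos_even_power])
  have norm_f: "has_bochner_integral lborel (\<lambda>\<theta>. norm (f m \<theta>)) (pi / 2 * (\<bar>x\<bar> ^ m / (fact m)\<^sup>2))" for m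
  proof -
    have eq: "(\<lambda>\<theta>. norm (f m \<theta>)) =
        (\<lambda>\<theta>. (4 * \<bar>x\<bar>) ^ m / fact (2 * m) * (indicator {0..pi/2} \<theta> * cos \<theta> ^ (2 * m)))"
      unfolding f_def by (auto simp: abs_mult power_abs power_mult split: split_indicator)
    show ?thesis
      unfolding eq scale[symmetric]
      by (rule has_bochner_integral_mult_right[OF has_bochner_integral_cos_even_power])
  qed
  have pointwise: "(\<lambda>m. f m \<theta>) sums (indicator {0..pi/2} \<theta> * E \<theta>)" for \<theta>
    using sums_mult[OF E[of \<theta>], of "indicator {0..pi/2} \<theta>"]
    unfolding f_def power_mult[of "cos \<theta>" 2] by (simp add: power_mult_distrib mult_ac)
  have int: "integrable lborel (f m)" for m using f[of m] by (simp add: has_bochner_integral_iff)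
  have summ: "summable (\<lambda>m. \<integral>t. norm (f m t) \<partial>lborel)"
    using norm_f summable_mult[OF summable_bessel_clifford_abs[of x], of "pi / 2"] 
    by (simp add: has_bochner_integral_iff)
  have AE: "AE \<theta> in lborel. summable (\<lambda>m. norm (f m \<theta>))"
  proof (intro AE_I2)
    fix \<theta> :: real
    have "summable (\<lambda>m. 1 / fact m * (4 * \<bar>x\<bar>) ^ m)"
      using summable_exp[of "4 * \<bar>x\<bar>"] by (simp add: divide_inverse)
    then show "summable (\<lambda>m. norm (f m \<theta>))"
    proof (rule summable_comparison_test'[where N = 0])
      fix m :: nat
      show "norm (norm (f m \<theta>)) \<le> 1 / fact m * (4 * \<bar>x\<bar>) ^ m"
    proof -
      have c': "\<bar>cos \<theta>\<bar> ^ (2 * m) \<le> 1" by (intro power_le_one) auto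
      then have c: "cos \<theta> ^ (2 * m) \<le> 1" by (simp only: power_even_abs[of "2 * m"] dvd_triv_left)
      have "norm (norm (f m \<theta>)) \<le> (4 * \<bar>x\<bar>) ^ m / fact (2 * m) * 1"
        unfolding f_def real_norm_def abs_idempotent abs_mult
        using c c' by (intro mult_mono) (auto simp: power_abs abs_mult split: split_indicator)
      also have "\<dots> \<le> (4 * \<bar>x\<bar>) ^ m / fact m * 1"
        by (intro mult_right_mono divide_left_mono fact_mono) auto
      finally show ?thesis by simp
    qed
    qed
  qed
  have "(\<integral>t. (\<Sum>m. f m t) \<partial>lborel) = (\<Sum>m. \<integral>t. f m t \<partial>lborel)"
    by (rule integral_suminf[OF int AE summ])
  also have "\<dots> = pi / 2 * bessel_clifford x"
    using f summable_bessel_clifford[of x]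
    by (simp add: has_bochner_integral_iff bessel_clifford_def suminf_mult del: times_divide_eq_right times_divide_eq_left)
  finally have "has_bochner_integral lborel (\<lambda>t. \<Sum>m. f m t) (pi / 2 * bessel_clifford x)"
    using integrable_suminf[OF int AE summ] by (simp add: has_bochner_integral_iff)
  then show ?thesis using pointwise by (simp add: sums_iff)
qed

lemma has_bochner_integral_bessel_clifford_cosh:
  assumes "t \<ge> 0"
  shows "has_bochner_integral lborel (\<lambda>\<theta>. indicator {0..pi/2} \<theta> * cosh (2 * sqrt t * cos \<theta>)) (pi / 2 * bessel_clifford t)"
proof (rule has_bochner_integral_bessel_clifford)
  fix \<theta> :: real
  have "sqrt (4 * t * (cos \<theta>)\<^sup>2) = \<bar>2 * sqrt t * cos \<theta>\<bar>"
    using assms by (simp add: real_sqrt_mult abs_mult)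
  then show "(\<lambda>m. (4 * t * (cos \<theta>)\<^sup>2) ^ m / fact (2 * m)) sums cosh (2 * sqrt t * cos \<theta>)"
    using cosh_sqrt_sums[of "4 * t * (cos \<theta>)\<^sup>2"] assms by (simp add: cosh_real_abs)
qed

lemma has_bochner_integral_bessel_clifford_cos:
  assumes "t \<ge> 0"
  shows "has_bochner_integral lborel (\<lambda>\<theta>. indicator {0..pi/2} \<theta> * cos (2 * sqrt t * cos \<theta>)) (pi / 2 * bessel_clifford (- t))"
proof (rule has_bochner_integral_bessel_clifford)
  fix \<theta> :: real
  have "(- 1) ^ m / fact (2 * m) * (2 * sqrt t * cos \<theta>) ^ (2 * m) = (4 * (- t) * (cos \<theta>)\<^sup>2) ^ m / fact (2 * m)" for m
  proof -
    have "(- 1) ^ m * (2 * sqrt t * cos \<theta>) ^ (2 * m) = ((- 1) * (2 * sqrt t * cos \<theta>)\<^sup>2) ^ m"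
      by (simp only: power_mult power_mult_distrib)
    also have "(- 1) * (2 * sqrt t * cos \<theta>)\<^sup>2 = 4 * (- t) * (cos \<theta>)\<^sup>2"
      using assms by (simp add: power_mult_distrib)
    finally show ?thesis by simp
  qed
  then show "(\<lambda>m. (4 * (- t) * (cos \<theta>)\<^sup>2) ^ m / fact (2 * m)) sums cos (2 * sqrt t * cos \<theta>)"
    using cos_paired[of "2 * sqrt t * cos \<theta>"] by simp
qed

section \<open>Laplace's method for the modified Bessel function\<close>

lemma continuous_tendsto_imp_bounded:
  fixes f :: "real \<Rightarrow> real"
  assumes cont: "\<And>t. t \<ge> 0 \<Longrightarrow> isCont f t" and lim: "(f \<longlongrightarrow> l) at_top"
  obtains M where "\<And>t. t \<ge> 0 \<Longrightarrow> \<bar>f t\<bar> \<le> M"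
proof -
  have "eventually (\<lambda>t. dist (f t) l < 1) at_top" using lim by (rule tendstoD) simp
  then obtain T where T: "\<And>t. t \<ge> T \<Longrightarrow> dist (f t) l < 1" by (auto simp: eventually_at_top_linorder)
  have "continuous_on {0..T} f" by (intro continuous_at_imp_continuous_on ballI cont) auto
  then have "bounded (f ` {0..T})" by (intro compact_imp_bounded compact_continuous_image compact_Icc)
  then obtain K where K: "\<forall>t\<in>{0..T}. norm (f t) \<le> K" unfolding bounded_iff by auto
  show ?thesis
  proof (rule that[of "max K (\<bar>l\<bar> + 1)"])
    fix t :: real assume "t \<ge> 0"
    then show "\<bar>f t\<bar> \<le> max K (\<bar>l\<bar> + 1)"
      using K[rule_format, of t] T[of t] by (cases "t \<le> T") (auto simp: dist_real_def)
  qed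
qed

text \<open>A quadratic lower bound for the phase. Its constant is not sharp; it only has to provide a Gaussian
majorant for Laplace's method.\<close>
lemma one_minus_cos_ge:
  assumes "0 \<le> \<theta>" "\<theta> \<le> pi / 2"
  shows "\<theta>\<^sup>2 / 8 \<le> 1 - cos \<theta>"
proof -
  have "sin 0 - 0 / 2 \<le> sin (\<theta> / 2) - (\<theta> / 2) / 2"
  proof (rule DERIV_nonneg_imp_nondecreasing[where f = "\<lambda>x. sin x - x / 2"])
    fix x assume x: "0 \<le> x" "x \<le> \<theta> / 2"
    have "cos (pi / 3) \<le> cos x" using x assms by (intro cos_monotone_0_pi_le) auto
    then have "cos x - 1 / 2 \<ge> 0" by (simp add: cos_60)
    moreover have "((\<lambda>x. sin x - x / 2) has_real_derivative cos x - 1 / 2) (at x)"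
      by (auto intro!: derivative_eq_intros)
    ultimately show "\<exists>d. ((\<lambda>x. sin x - x / 2) has_real_derivative d) (at x) \<and> d \<ge> 0" by blast
  qed (use assms in auto)
  then have "(\<theta> / 4)\<^sup>2 \<le> (sin (\<theta> / 2))\<^sup>2" using assms by (intro power_mono) auto
  moreover have "cos \<theta> = 1 - 2 * (sin (\<theta> / 2))\<^sup>2" using cos_double_sin[of "\<theta> / 2"] by simp
  ultimately show ?thesis by (simp add: power_divide)
qed

lemma has_bochner_integral_half_gaussian:
  fixes c :: real assumes "c > 0"
  shows "has_bochner_integral lborel (\<lambda>w. indicator {0..} w * exp (- ((c * w)\<^sup>2))) (sqrt pi / 2 / c)"
proof -
  have "has_bochner_integral lborel (\<lambda>w. indicator {0..} (0 + c * w) *\<^sub>R exp (- (0 + c * w)\<^sup>2)) ((sqrt pi / 2) /\<^sub>R \<bar>c\<bar>)"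
    using gaussian_moment_0 assms
    by (subst (asm) lborel_has_bochner_integral_real_affine_iff[where c=c and t=0]) auto
  moreover have "indicator {0..} (c * w) = (indicator {0..} w :: real)" for w
    using assms by (auto simp: zero_le_mult_iff split: split_indicator)
  ultimately show ?thesis using assms by (simp add: field_simps)
qed

text \<open>After the substitution $\theta = w/\sqrt z$ the exponent $z(1 - \cos(w/\sqrt z))$ tends to $w^2/2$,
and the integral to that of half a Gaussian.\<close>
lemma laplace_method_one_minus_cos:
  "((\<lambda>z. \<integral>w. indicator {0..pi/2 * sqrt z} w * exp (- (z * (1 - cos (w / sqrt z)))) \<partial>lborel)
     \<longlongrightarrow> sqrt (pi / 2)) at_top"
proof -
  have "((\<lambda>z. \<integral>w. indicator {0..pi/2 * sqrt z} w * exp (- (z * (1 - cos (w / sqrt z)))) \<partial>lborel)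
     \<longlongrightarrow> (\<integral>w. indicator {0..} w * exp (- ((1 / sqrt 2 * w)\<^sup>2)) \<partial>lborel)) at_top"
  proof (rule integral_dominated_convergence_at_top)
    show "integrable lborel (\<lambda>w::real. indicator {0..} w * exp (- ((1 / sqrt 8 * w)\<^sup>2)))"
      using has_bochner_integral_half_gaussian[of "1 / sqrt 8"] by (simp add: has_bochner_integral_iff)
    show "AE w in lborel. ((\<lambda>z. indicator {0..pi/2 * sqrt z} w * exp (- (z * (1 - cos (w / sqrt z)))))
        \<longlongrightarrow> indicator {0..} w * exp (- ((1 / sqrt 2 * w)\<^sup>2))) at_top"
    proof (rule AE_I2)
      fix w :: real
      consider "w < 0" | "w = 0" | "w > 0" by linarith
      then show "((\<lambda>z. indicator {0..pi/2 * sqrt z} w * exp (- (z * (1 - cos (w / sqrt z)))))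
        \<longlongrightarrow> indicator {0..} w * exp (- ((1 / sqrt 2 * w)\<^sup>2))) at_top"
      proof cases
        case 2
        then show ?thesis 
          by (intro tendsto_eventually eventually_mono[OF eventually_ge_at_top[of 0]]) auto
      next
        case 3
        have "((\<lambda>z. exp (- (z * (1 - cos (w / sqrt z))))) \<longlongrightarrow> exp (- (w\<^sup>2 / 2))) at_top"
          using 3 by (intro tendsto_intros) (real_asymp simp: power2_eq_square)
        moreover have "eventually (\<lambda>z. w \<le> pi/2 * sqrt z) at_top"
          using 3 by real_asymp
        then have "eventually (\<lambda>z. exp (- (z * (1 - cos (w / sqrt z)))) = 
            indicator {0..pi/2 * sqrt z} w * exp (- (z * (1 - cos (w / sqrt z))))) at_top"
          by eventually_elim (use 3 in auto)
        ultimately have "((\<lambda>z. indicator {0..pi/2 * sqrt z} w * exp (- (z * (1 - cos (w / sqrt z)))))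
          \<longlongrightarrow> exp (- (w\<^sup>2 / 2))) at_top"
          by (rule Lim_transform_eventually)
        then show ?thesis using 3 by (simp add: power_divide)
      qed auto
    qed
    show "eventually (\<lambda>z. AE w in lborel. norm (indicator {0..pi/2 * sqrt z} w * exp (- (z * (1 - cos (w / sqrt z)))))
        \<le> indicator {0..} w * exp (- ((1 / sqrt 8 * w)\<^sup>2))) at_top"
      using eventually_gt_at_top[of 0]
    proof eventually_elim
      case (elim z)
      have "(1 / sqrt 8 * w)\<^sup>2 \<le> z * (1 - cos (w / sqrt z))" if "0 \<le> w" "w \<le> pi/2 * sqrt z" for w
      proof -
        have "(w / sqrt z)\<^sup>2 / 8 \<le> 1 - cos (w / sqrt z)"
          using that elim by (intro one_minus_cos_ge) (auto simp: field_simps)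
        from mult_left_mono[OF this, of z] show ?thesis using elim by (simp add: power_divide)
      qed
      then show ?case by (intro AE_I2) (auto split: split_indicator)
    qed
  qed auto
  also have "(\<integral>w. indicator {0..} w * exp (- ((1 / sqrt 2 * w)\<^sup>2)) \<partial>lborel) = sqrt pi / 2 / (1 / sqrt 2)"
    using has_bochner_integral_half_gaussian[of "1 / sqrt 2"] by (simp add: has_bochner_integral_iff)
  also have "\<dots> = sqrt (pi / 2)"
    by (simp add: real_sqrt_divide field_simps)
  finally show ?thesis .
qed

text \<open>With $z = 2\sqrt t$, the hyperbolic cosine is half the sum of $e^{z\cos\theta}$, to which Laplace's
method applies, and of $e^{-z\cos\theta} \le 1$, which is negligible against $e^z$. The amplitude uses
$1 + t$ instead of $t$ to stay bounded near 0, where its ratios under shifts have to be controlled as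
well.\<close>
lemma bessel_clifford_asymptotic_pos:
  "((\<lambda>t. bessel_clifford t / ((1 + t) powr (- (1 / 4)) * exp (2 * sqrt t))) \<longlongrightarrow> 1 / (2 * sqrt pi)) at_top"
proof -
  define A where "A z = (\<integral>w. indicator {0..pi/2 * sqrt z} w * exp (- (z * (1 - cos (w / sqrt z)))) \<partial>lborel)" for z
  define R where "R z = (\<integral>\<theta>. indicator {0..pi/2} \<theta> * exp (- (z * cos \<theta>)) \<partial>lborel)" for z
  have bessel: "sqrt z * exp (- z) * bessel_clifford t = 1 / pi * (A z + sqrt z * exp (- z) * R z)"
    if t: "t > 0" and z: "z = 2 * sqrt t" for t z
  proof -
    have z0: "z > 0" using t z by simp
    have int: "integrable lborel (\<lambda>\<theta>. indicator {0..pi/2} \<theta> * exp (c * cos \<theta>))" for c :: real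
    proof -
      have "continuous_on {0..pi/2} (\<lambda>\<theta>. exp (c * cos \<theta>))" by (intro continuous_intros)
      from borel_integrable_atLeastAtMost'[OF this] show ?thesis by (simp add: set_integrable_def)
    qed
    have A: "A z = sqrt z * exp (- z) * (\<integral>\<theta>. indicator {0..pi/2} \<theta> * exp (z * cos \<theta>) \<partial>lborel)"
    proof -
      have "(\<integral>\<theta>. indicator {0..pi/2} \<theta> * exp (- (z * (1 - cos \<theta>))) \<partial>lborel)
        = \<bar>1 / sqrt z\<bar> *\<^sub>R (\<integral>w. indicator {0..pi/2} (0 + 1 / sqrt z * w) * exp (- (z * (1 - cos (0 + 1 / sqrt z * w)))) \<partial>lborel)"
        using z0 by (intro lborel_integral_real_affine) auto
      also have "(\<integral>w. indicator {0..pi/2} (0 + 1 / sqrt z * w) * exp (- (z * (1 - cos (0 + 1 / sqrt z * w)))) \<partial>lborel) = A z"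
        unfolding A_def using z0
        by (intro Bochner_Integration.integral_cong) (auto simp: field_simps zero_le_mult_iff split: split_indicator)
      finally have "A z = sqrt z * (\<integral>\<theta>. indicator {0..pi/2} \<theta> * exp (- (z * (1 - cos \<theta>))) \<partial>lborel)"
        using z0 by simp
      also have "(\<integral>\<theta>. indicator {0..pi/2} \<theta> * exp (- (z * (1 - cos \<theta>))) \<partial>lborel)
          = (\<integral>\<theta>. exp (- z) * (indicator {0..pi/2} \<theta> * exp (z * cos \<theta>)) \<partial>lborel)"
        by (intro Bochner_Integration.integral_cong) (auto simp: exp_add[symmetric] algebra_simps split: split_indicator)
      finally show ?thesis by simp
    qed
    have "pi / 2 * bessel_clifford t = (\<integral>\<theta>. indicator {0..pi/2} \<theta> * cosh (z * cos \<theta>) \<partial>lborel)"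
      using has_bochner_integral_bessel_clifford_cosh[of t] t by (simp add: has_bochner_integral_iff z)
    also have "\<dots> = (\<integral>\<theta>. 1 / 2 * (indicator {0..pi/2} \<theta> * exp (z * cos \<theta>)) + 1 / 2 * (indicator {0..pi/2} \<theta> * exp ((- z) * cos \<theta>)) \<partial>lborel)"
      by (intro Bochner_Integration.integral_cong) (auto simp: cosh_def field_simps)
    also have "\<dots> = 1 / 2 * (\<integral>\<theta>. indicator {0..pi/2} \<theta> * exp (z * cos \<theta>) \<partial>lborel) + 1 / 2 * R z"
      unfolding R_def using int[of z] int[of "- z"] by (subst Bochner_Integration.integral_add) auto
    finally have "bessel_clifford t = 1 / pi * ((\<integral>\<theta>. indicator {0..pi/2} \<theta> * exp (z * cos \<theta>) \<partial>lborel) + R z)"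
      by (simp add: field_simps)
    then show ?thesis unfolding A by (simp only:) (simp add: algebra_simps add_divide_distrib)
  qed
  have R: "\<bar>R z\<bar> \<le> pi / 2" if "z > 0" for z
  proof -
    have "\<bar>R z\<bar> \<le> (\<integral>\<theta>. indicator {0..pi/2} \<theta> \<partial>lborel)"
      unfolding R_def real_norm_def[symmetric]
    proof (rule Bochner_Integration.integral_norm_bound_integral)
      show "integrable lborel (\<lambda>\<theta>. indicator {0..pi/2} \<theta> * exp (- (z * cos \<theta>)))"
      proof -
        have "continuous_on {0..pi/2} (\<lambda>\<theta>. exp (- (z * cos \<theta>)))" by (intro continuous_intros)
        from borel_integrable_atLeastAtMost'[OF this] show ?thesis by (simp add: set_integrable_def)
      qed
      show "norm (indicator {0..pi/2} \<theta> * exp (- (z * cos \<theta>))) \<le> indicator {0..pi/2} \<theta>" for \<theta> :: real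
        using cos_ge_zero[of \<theta>] that by (auto split: split_indicator)
    qed auto
    then show ?thesis by simp
  qed
  have "((\<lambda>z. sqrt z * exp (- z) * R z) \<longlongrightarrow> 0) at_top"
  proof (rule Lim_null_comparison)
    show "eventually (\<lambda>z. norm (sqrt z * exp (- z) * R z) \<le> sqrt z * exp (- z) * (pi / 2)) at_top"
      using eventually_gt_at_top[of 0] 
      by eventually_elim (use R in \<open>auto simp: abs_mult intro!: mult_left_mono\<close>)
    show "((\<lambda>z. sqrt z * exp (- z) * (pi / 2)) \<longlongrightarrow> 0) at_top" by real_asymp
  qed
  then have "((\<lambda>z. 1 / pi * (A z + sqrt z * exp (- z) * R z)) \<longlongrightarrow> 1 / pi * (sqrt (pi / 2) + 0)) at_top"
    using laplace_method_one_minus_cos unfolding A_def by (intro tendsto_intros)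
  moreover have "filterlim (\<lambda>t. 2 * sqrt t) at_top at_top" by real_asymp
  ultimately have 1: "((\<lambda>t. 1 / pi * (A (2 * sqrt t) + sqrt (2 * sqrt t) * exp (- (2 * sqrt t)) * R (2 * sqrt t))) \<longlongrightarrow> 1 / pi * (sqrt (pi / 2) + 0)) at_top"
    by (rule filterlim_compose)
  have 2: "((\<lambda>t::real. (1 + t) powr (1 / 4) / sqrt (2 * sqrt t)) \<longlongrightarrow> 1 / sqrt 2) at_top"
    by (real_asymp simp: powr_half_sqrt inverse_eq_divide)
  have "((\<lambda>t. 1 / pi * (A (2 * sqrt t) + sqrt (2 * sqrt t) * exp (- (2 * sqrt t)) * R (2 * sqrt t)) * ((1 + t) powr (1 / 4) / sqrt (2 * sqrt t)))
      \<longlongrightarrow> 1 / pi * (sqrt (pi / 2) + 0) * (1 / sqrt 2)) at_top"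
    by (rule tendsto_mult[OF 1 2])
  also have "1 / pi * (sqrt (pi / 2) + 0) * (1 / sqrt 2) = 1 / (2 * sqrt pi)"
    by (simp add: real_sqrt_divide field_simps)
  finally show ?thesis
  proof (rule Lim_transform_eventually)
    show "eventually (\<lambda>t. 1 / pi * (A (2 * sqrt t) + sqrt (2 * sqrt t) * exp (- (2 * sqrt t)) * R (2 * sqrt t)) * ((1 + t) powr (1 / 4) / sqrt (2 * sqrt t))
        = bessel_clifford t / ((1 + t) powr (- (1 / 4)) * exp (2 * sqrt t))) at_top"
      using eventually_gt_at_top[of 0]
    proof eventually_elim
      case (elim t)
      show ?case unfolding bessel[OF elim refl, symmetric]
        using elim by (simp add: powr_minus exp_minus field_simps)
    qed
  qed
qed

lemma bessel_clifford_bound_pos: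
  obtains M where "\<And>t. t > 0 \<Longrightarrow> \<bar>bessel_clifford t\<bar> \<le> M * ((1 + t) powr (- (1 / 4)) * exp (2 * sqrt t))"
proof -
  define f where "f t = bessel_clifford t / ((1 + t) powr (- (1 / 4)) * exp (2 * sqrt t))" for t
  have "isCont f t" if "t \<ge> 0" for t
    unfolding f_def using that isCont_bessel_clifford by (intro continuous_intros) auto
  from continuous_tendsto_imp_bounded[OF this bessel_clifford_asymptotic_pos[folded f_def]]
  obtain M where M: "\<And>t. t \<ge> 0 \<Longrightarrow> \<bar>f t\<bar> \<le> M" by blast
  show ?thesis
  proof (rule that)
    fix t :: real assume "t > 0"
    then show "\<bar>bessel_clifford t\<bar> \<le> M * ((1 + t) powr (- (1 / 4)) * exp (2 * sqrt t))"
      using M[of t] by (simp add: f_def abs_divide abs_mult field_simps)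
  qed
qed

section \<open>Stationary phase for the Bessel function of the first kind\<close>

lemma sqrt_2_half: "sqrt 2 / 2 = 1 / sqrt (2 :: real)"
  by (rule frac_eq_eq[THEN iffD2]) auto

text \<open>A primitive of $e^{-w^2}$ on the whole plane takes the place of contour integrals: its increments do
not depend on the path.\<close>
lemma gaussian_primitive:
  obtains F :: "complex \<Rightarrow> complex" where "\<And>w. (F has_field_derivative exp (- w\<^sup>2)) (at w)"
proof -
  have "(\<lambda>w::complex. exp (- w\<^sup>2)) holomorphic_on UNIV" by (intro holomorphic_intros)
  then show ?thesis
  proof (rule holomorphic_convex_primitive'[OF convex_UNIV open_UNIV])
    fix F :: "complex \<Rightarrow> complex"
    assume "\<And>w. w \<in> UNIV \<Longrightarrow> (F has_field_derivative exp (- w\<^sup>2)) (at w within UNIV)"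
    then have "(F has_field_derivative exp (- w\<^sup>2)) (at w)" for w by simp
    then show ?thesis by (rule that)
  qed
qed

lemma gaussian_primitive_real_axis:
  fixes F :: "complex \<Rightarrow> complex"
  assumes F: "\<And>w. (F has_field_derivative exp (- w\<^sup>2)) (at w)"
  shows "F (of_real x) - F 0 = of_real (sqrt pi / 2 * erf x)"
proof -
  define D where "D x = F (of_real x) - of_real (sqrt pi / 2 * erf x)" for x
  have "(D has_vector_derivative 0) (at x within UNIV)" for x
  proof -
    have "(D has_vector_derivative (exp (- (of_real x)\<^sup>2) - of_real (sqrt pi / 2 * (2 / sqrt pi * exp (- x\<^sup>2))))) (at x)"
      unfolding D_def
    proof (intro has_vector_derivative_diff has_vector_derivative_of_real has_vector_derivative_real_field)
      show "((\<lambda>x. sqrt pi / 2 * erf x) has_real_derivative sqrt pi / 2 * (2 / sqrt pi * exp (- x\<^sup>2))) (at x)"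
        by (rule DERIV_cmult[OF erf_has_real_derivative])
    qed (rule F)
    also have "exp (- (of_real x)\<^sup>2) - of_real (sqrt pi / 2 * (2 / sqrt pi * exp (- x\<^sup>2))) = (0 :: complex)"
      by (simp flip: exp_of_real)
    finally show ?thesis by simp
  qed
  then obtain c where "\<And>x. x \<in> UNIV \<Longrightarrow> D x = c"
    using has_vector_derivative_zero_constant[of UNIV D] by auto
  then have "D x = D 0" by simp
  then show ?thesis by (simp add: D_def algebra_simps)
qed

text \<open>On the segment from $x$ to $x + ix$ the integrand is bounded by $e^{y^2 - x^2} \le e^{xy - x^2}$, where $y$ is the
imaginary part, and the integral of this bound over $[0,x]$ is at most $1/x$.\<close>
lemma gaussian_primitive_vertical_segment:
  fixes F :: "complex \<Rightarrow> complex"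
  assumes F: "\<And>w. (F has_field_derivative exp (- w\<^sup>2)) (at w)"
  assumes x: "x > 0"
  shows "norm (F ((1 + \<i>) * of_real x) - F (of_real x)) \<le> 1 / x"
proof -
  define p where "p y = of_real x + \<i> * of_real y" for y :: real
  have "((\<lambda>y. \<i> * exp (- (p y)\<^sup>2)) has_integral (F (p x) - F (p 0))) {0..x}"
  proof (rule fundamental_theorem_of_calculus)
    fix y :: real
    have "(p has_vector_derivative \<i>) (at y within {0..x})"
      unfolding p_def by (auto intro!: derivative_eq_intros)
    from field_vector_diff_chain_within[OF this, of F "exp (- (p y)\<^sup>2)"]
    show "((\<lambda>y. F (p y)) has_vector_derivative \<i> * exp (- (p y)\<^sup>2)) (at y within {0..x})"
      using has_field_derivative_at_within[OF F] by (simp add: o_def)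
  qed (use x in simp)
  moreover have "((\<lambda>y. exp (x * y - x\<^sup>2)) has_integral (exp (x * x - x\<^sup>2) / x - exp (x * 0 - x\<^sup>2) / x)) {0..x}"
    by (rule fundamental_theorem_of_calculus)
       (use x in \<open>auto intro!: derivative_eq_intros simp: has_real_derivative_iff_has_vector_derivative[symmetric]\<close>)
  moreover have "norm (\<i> * exp (- (p y)\<^sup>2)) \<le> exp (x * y - x\<^sup>2)" if "y \<in> {0..x}" for y
  proof -
    have "norm (\<i> * exp (- (p y)\<^sup>2)) = exp (y\<^sup>2 - x\<^sup>2)"
      by (simp add: norm_mult p_def power2_eq_square algebra_simps)
    also have "y\<^sup>2 \<le> x * y" using that by (simp add: power2_eq_square mult_right_mono)
    finally show ?thesis by simp
  qed
  ultimately have "norm (F (p x) - F (p 0)) \<le> exp (x * x - x\<^sup>2) / x - exp (x * 0 - x\<^sup>2) / x"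
    by (metis (no_types, lifting) Henstock_Kurzweil_Integration.integral_norm_bound_integral has_integral_iff)
  also have "\<dots> \<le> 1 / x" using x by (simp add: power2_eq_square)
  finally show ?thesis by (simp add: p_def algebra_simps)
qed

text \<open>The increment along the diagonal $(1 + i)\,\mathbf{R}$, a Fresnel integral, has the same limit
as the Gaussian integral along the real axis, because the vertical segment closing the triangle
contributes $O(1/x)$.\<close>
lemma fresnel_limit:
  fixes F :: "complex \<Rightarrow> complex"
  assumes F: "\<And>w. (F has_field_derivative exp (- w\<^sup>2)) (at w)"
  shows "((\<lambda>x. F ((1 + \<i>) * of_real x) - F 0) \<longlongrightarrow> of_real (sqrt pi / 2)) at_top"
proof -
  have "((\<lambda>x. F ((1 + \<i>) * of_real x) - F (of_real x)) \<longlongrightarrow> 0) at_top"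
  proof (rule Lim_null_comparison)
    show "eventually (\<lambda>x. norm (F ((1 + \<i>) * of_real x) - F (of_real x)) \<le> 1 / x) at_top"
      using eventually_gt_at_top[of 0] by eventually_elim (rule gaussian_primitive_vertical_segment[OF F])
    show "((\<lambda>x::real. 1 / x) \<longlongrightarrow> 0) at_top" by real_asymp
  qed
  moreover have "((\<lambda>x. F (of_real x) - F 0) \<longlongrightarrow> of_real (sqrt pi / 2 * 1)) at_top"
    unfolding gaussian_primitive_real_axis[OF F] by (intro tendsto_intros erf_tendsto_at_top)
  ultimately have "((\<lambda>x. (F ((1 + \<i>) * of_real x) - F (of_real x)) + (F (of_real x) - F 0))
      \<longlongrightarrow> 0 + of_real (sqrt pi / 2 * 1)) at_top"
    by (rule tendsto_add)
  then show ?thesis by simp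
qed

text \<open>The only stationary point of $\cos\theta$ in $[0, \pi/2]$ is 0. Since
$\cos\theta = 1 - 2\sin^2(\theta/2)$, the substitution $w = (1 + i) \sqrt z \sin(\theta/2)$ makes the
oscillating factor exactly $e^{iz} e^{-w^2}$, and the weight $\cos(\theta/2)$ is what turns
$d\theta$ into a multiple of $dw$.\<close>
lemma stationary_phase_main_part:
  fixes F :: "complex \<Rightarrow> complex"
  assumes F: "\<And>w. (F has_field_derivative exp (- w\<^sup>2)) (at w)"
  assumes z: "z > 0"
  shows "((\<lambda>\<theta>. exp (\<i> * of_real (z * cos \<theta>)) * of_real (cos (\<theta> / 2))) has_integral
            exp (\<i> * of_real z) * (2 / ((1 + \<i>) * of_real (sqrt z)))
              * (F ((1 + \<i>) * of_real (sqrt z / sqrt 2)) - F 0)) {0..pi/2}"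
proof -
  define p where "p \<theta> = (1 + \<i>) * of_real (sqrt z * sin (\<theta> / 2))" for \<theta>
  define C where "C = exp (\<i> * of_real z) * (2 / ((1 + \<i>) * of_real (sqrt z)))"
  have nz: "1 + \<i> \<noteq> 0" by (simp add: complex_eq_iff)
  have "((\<lambda>\<theta>. exp (\<i> * of_real (z * cos \<theta>)) * of_real (cos (\<theta> / 2))) has_integral
            (C * F (p (pi / 2)) - C * F (p 0))) {0..pi/2}"
  proof (rule fundamental_theorem_of_calculus)
    fix \<theta> :: real
    have "((\<lambda>\<theta>. sqrt z * sin (\<theta> / 2)) has_real_derivative sqrt z * cos (\<theta> / 2) / 2) (at \<theta> within {0..pi/2})"
      by (auto intro!: derivative_eq_intros)
    then have "(p has_vector_derivative (1 + \<i>) * of_real (sqrt z * cos (\<theta> / 2) / 2)) (at \<theta> within {0..pi/2})"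
      unfolding p_def by (intro has_vector_derivative_mult_right has_vector_derivative_of_real)
    from field_vector_diff_chain_within[OF this has_field_derivative_at_within[OF F]]
    have "((\<lambda>\<theta>. C * F (p \<theta>)) has_vector_derivative
             C * ((1 + \<i>) * of_real (sqrt z * cos (\<theta> / 2) / 2) * exp (- (p \<theta>)\<^sup>2))) (at \<theta> within {0..pi/2})"
      unfolding o_def by (rule has_vector_derivative_mult_right)
    also have "C * ((1 + \<i>) * of_real (sqrt z * cos (\<theta> / 2) / 2) * exp (- (p \<theta>)\<^sup>2))
        = (exp (\<i> * of_real z) * exp (- (p \<theta>)\<^sup>2)) * of_real (cos (\<theta> / 2))"
    proof -
      have "e * (2 / (c * s)) * (c * (s * k / 2) * g) = (e * g) * k"
        if "c \<noteq> 0" "s \<noteq> 0" for e c s k g :: complex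
        using that by (simp add: field_simps)
      from this[of "1 + \<i>" "of_real (sqrt z)"] show ?thesis
        using nz z unfolding C_def by simp
    qed
    also have "exp (\<i> * of_real z) * exp (- (p \<theta>)\<^sup>2) = exp (\<i> * of_real (z * cos \<theta>))"
    proof -
      have c: "cos \<theta> = 1 - 2 * (sin (\<theta> / 2))\<^sup>2" using cos_double_sin[of "\<theta> / 2"] by simp
      have "(1 + \<i>)\<^sup>2 = 2 * \<i>" by (simp add: power2_eq_square algebra_simps)
      then have "(p \<theta>)\<^sup>2 = 2 * \<i> * of_real ((sqrt z)\<^sup>2 * (sin (\<theta> / 2))\<^sup>2)"
        unfolding p_def power_mult_distrib by (simp only: of_real_power[symmetric] power_mult_distrib)
      also have "(sqrt z)\<^sup>2 = z" using z by simp
      finally have "\<i> * of_real z + - (p \<theta>)\<^sup>2 = \<i> * of_real (z * cos \<theta>)"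
        unfolding c by (simp add: algebra_simps)
      then show ?thesis unfolding exp_add[symmetric] by simp
    qed
    finally show "((\<lambda>\<theta>. C * F (p \<theta>)) has_vector_derivative
        exp (\<i> * of_real (z * cos \<theta>)) * of_real (cos (\<theta> / 2))) (at \<theta> within {0..pi/2})" .
  qed simp
  moreover have "p (pi / 2) = (1 + \<i>) * of_real (sqrt z / sqrt 2)"
  proof -
    have "sin (pi / 2 / 2) = 1 / sqrt 2" by (simp add: sin_45 sqrt_2_half)
    then show ?thesis unfolding p_def by simp
  qed
  ultimately show ?thesis by (simp add: p_def C_def right_diff_distrib)
qed

text \<open>The complementary weight $1 - \cos(\theta/2)$ vanishes at the stationary point. Divided by
$\sin\theta$, it is the smooth function $\tan(\theta/4)/(2\cos(\theta/2))$, so that one integration by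
parts gains a factor $1/z$.\<close>
lemma nonstationary_part_bound:
  obtains C where "\<And>z. z > 0 \<Longrightarrow> norm (integral {0..pi/2}
       (\<lambda>\<theta>. exp (\<i> * of_real (z * cos \<theta>)) * of_real (1 - cos (\<theta> / 2)))) \<le> C / z"
proof -
  define h where "h \<theta> = tan (\<theta> / 4) / (2 * cos (\<theta> / 2))" for \<theta> :: real
  define h' where "h' \<theta> = (inverse ((cos (\<theta> / 4))\<^sup>2) / 4 * (2 * cos (\<theta> / 2)) + tan (\<theta> / 4) * sin (\<theta> / 2))
       / (2 * cos (\<theta> / 2) * (2 * cos (\<theta> / 2)))" for \<theta> :: real
  have cos4: "cos (\<theta> / 4) > 0" and cos2: "cos (\<theta> / 2) > 0" if "\<theta> \<in> {0..pi/2}" for \<theta> :: real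
  proof -
    have "0 \<le> \<theta>" "\<theta> \<le> pi / 2" using that by auto
    then have "- (pi / 2) < \<theta> / 4" "\<theta> / 4 < pi / 2" "- (pi / 2) < \<theta> / 2" "\<theta> / 2 < pi / 2"
      using pi_gt_zero by linarith+
    then show "cos (\<theta> / 4) > 0" "cos (\<theta> / 2) > 0" by (simp_all only: cos_gt_zero_pi)
  qed
  have deriv: "(h has_real_derivative h' \<theta>) (at \<theta> within {0..pi/2})" if "\<theta> \<in> {0..pi/2}" for \<theta>
    unfolding h_def[abs_def] h'_def using cos4[OF that] cos2[OF that]
    by (auto intro!: derivative_eq_intros)
  have h_eq: "sin \<theta> * h \<theta> = 1 - cos (\<theta> / 2)" if "\<theta> \<in> {0..pi/2}" for \<theta>
  proof -
    have "sin \<theta> = 2 * (2 * sin (\<theta> / 4) * cos (\<theta> / 4)) * cos (\<theta> / 2)"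
      using sin_double[of "\<theta> / 2"] sin_double[of "\<theta> / 4"] by simp
    moreover have "2 * (2 * s * c) * d * (s / c / (2 * d)) = 2 * s\<^sup>2" if "c > 0" "d > 0" for s c d :: real
      using that by (simp add: field_simps power2_eq_square)
    moreover have "1 - cos (\<theta> / 2) = 2 * (sin (\<theta> / 4))\<^sup>2" using cos_double_sin[of "\<theta> / 4"] by simp
    ultimately show ?thesis
      unfolding h_def tan_def using cos4[OF that] cos2[OF that] by (simp only:)
  qed
  have cont: "continuous_on {0..pi/2} h'"
    unfolding h'_def[abs_def] 
    by (intro continuous_intros) (use cos4 cos2 in force)+
  then have "bounded (h' ` {0..pi/2})" by (intro compact_imp_bounded compact_continuous_image compact_Icc)
  then obtain K where K: "\<forall>\<theta>\<in>{0..pi/2}. norm (h' \<theta>) \<le> K" unfolding bounded_iff by auto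
  show ?thesis
  proof (rule that)
    fix z :: real assume z: "z > 0"
    define e where "e \<theta> = exp (\<i> * of_real (z * cos \<theta>))" for \<theta>
    have norm_e: "norm (e \<theta>) = 1" for \<theta> by (simp add: e_def)
    have cont_e: "continuous_on {0..pi/2} e" unfolding e_def[abs_def] by (intro continuous_intros)
    define q where "q \<theta> = \<i> / of_real z * (of_real (h \<theta>) * e \<theta>)" for \<theta>
    have "((\<lambda>\<theta>. e \<theta> * of_real (1 - cos (\<theta> / 2)) + \<i> / of_real z * (of_real (h' \<theta>) * e \<theta>)) has_integral (q (pi / 2) - q 0)) {0..pi/2}"
    proof (rule fundamental_theorem_of_calculus)
      fix \<theta> :: real assume \<theta>: "\<theta> \<in> {0..pi/2}"
      have "((\<lambda>\<theta>. z * cos \<theta>) has_real_derivative - z * sin \<theta>) (at \<theta> within {0..pi/2})"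
        by (auto intro!: derivative_eq_intros)
      then have "((\<lambda>\<theta>. \<i> * of_real (z * cos \<theta>)) has_vector_derivative \<i> * of_real (- z * sin \<theta>)) (at \<theta> within {0..pi/2})"
        by (intro has_vector_derivative_mult_right has_vector_derivative_of_real)
      from field_vector_diff_chain_within[OF this has_field_derivative_at_within[OF DERIV_exp]]
      have e': "(e has_vector_derivative \<i> * of_real (- z * sin \<theta>) * e \<theta>) (at \<theta> within {0..pi/2})"
        unfolding o_def e_def[abs_def] .
      have h': "((\<lambda>\<theta>. of_real (h \<theta>) :: complex) has_vector_derivative of_real (h' \<theta>)) (at \<theta> within {0..pi/2})"
        by (rule has_vector_derivative_of_real[OF deriv[OF \<theta>]])
      have "(q has_vector_derivative \<i> / of_real z * (of_real (h \<theta>) * (\<i> * of_real (- z * sin \<theta>) * e \<theta>) + of_real (h' \<theta>) * e \<theta>))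
          (at \<theta> within {0..pi/2})"
        unfolding q_def[abs_def] by (intro has_vector_derivative_mult_right has_vector_derivative_mult e' h')
      also have "\<i> / of_real z * (of_real (h \<theta>) * (\<i> * of_real (- z * sin \<theta>) * e \<theta>) + of_real (h' \<theta>) * e \<theta>)
         = e \<theta> * of_real (sin \<theta> * h \<theta>) + \<i> / of_real z * (of_real (h' \<theta>) * e \<theta>)"
        using z by (simp add: field_simps)
      finally show "(q has_vector_derivative e \<theta> * of_real (1 - cos (\<theta> / 2)) + \<i> / of_real z * (of_real (h' \<theta>) * e \<theta>))
          (at \<theta> within {0..pi/2})"
        unfolding h_eq[OF \<theta>] .
    qed simp
    moreover have int: "(\<lambda>\<theta>. of_real (h' \<theta>) * e \<theta>) integrable_on {0..pi/2}"
      by (intro integrable_continuous_interval continuous_intros cont cont_e)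
    have "((\<lambda>\<theta>. \<i> / of_real z * (of_real (h' \<theta>) * e \<theta>)) has_integral 
          \<i> / of_real z * integral {0..pi/2} (\<lambda>\<theta>. of_real (h' \<theta>) * e \<theta>)) {0..pi/2}"
      by (intro has_integral_mult_right integrable_integral int)
    ultimately have "((\<lambda>\<theta>. e \<theta> * of_real (1 - cos (\<theta> / 2)) + \<i> / of_real z * (of_real (h' \<theta>) * e \<theta>) - \<i> / of_real z * (of_real (h' \<theta>) * e \<theta>)) has_integral
       (q (pi / 2) - q 0 - \<i> / of_real z * integral {0..pi/2} (\<lambda>\<theta>. of_real (h' \<theta>) * e \<theta>))) {0..pi/2}"
      by (rule has_integral_diff)
    then have eq: "integral {0..pi/2} (\<lambda>\<theta>. e \<theta> * of_real (1 - cos (\<theta> / 2))) =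
        q (pi / 2) - q 0 - \<i> / of_real z * integral {0..pi/2} (\<lambda>\<theta>. of_real (h' \<theta>) * e \<theta>)"
      by (simp add: integral_unique)
    have "norm (integral {0..pi/2} (\<lambda>\<theta>. of_real (h' \<theta>) * e \<theta>)) \<le> integral {0..pi/2} (\<lambda>\<theta>. K)"
      using K by (intro Henstock_Kurzweil_Integration.integral_norm_bound_integral int integrable_const_ivl) (simp add: norm_mult norm_e)
    then have I: "norm (integral {0..pi/2} (\<lambda>\<theta>. of_real (h' \<theta>) * e \<theta>)) \<le> K * (pi / 2)" by (simp add: mult.commute)
    have "norm (integral {0..pi/2} (\<lambda>\<theta>. e \<theta> * of_real (1 - cos (\<theta> / 2)))) \<le>
       norm (q (pi / 2)) + norm (q 0) + norm (\<i> / of_real z * integral {0..pi/2} (\<lambda>\<theta>. of_real (h' \<theta>) * e \<theta>))"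
      unfolding eq by (intro order_trans[OF norm_triangle_ineq4] add_mono order_refl)
    also have "\<dots> \<le> \<bar>h (pi / 2)\<bar> / z + \<bar>h 0\<bar> / z + K * (pi / 2) / z"
    proof (intro add_mono)
      have "norm (q \<theta>) = \<bar>h \<theta>\<bar> / z" for \<theta>
        using z by (simp add: q_def norm_mult norm_divide norm_e)
      then show "norm (q (pi / 2)) \<le> \<bar>h (pi / 2)\<bar> / z" "norm (q 0) \<le> \<bar>h 0\<bar> / z" by simp_all
      show "norm (\<i> / of_real z * integral {0..pi/2} (\<lambda>\<theta>. of_real (h' \<theta>) * e \<theta>)) \<le> K * (pi / 2) / z"
        unfolding norm_mult using divide_right_mono[OF I, of z] z by (simp add: norm_divide)
    qed
    finally show "norm (integral {0..pi/2} (\<lambda>\<theta>. exp (\<i> * of_real (z * cos \<theta>)) * of_real (1 - cos (\<theta> / 2))))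
        \<le> (\<bar>h (pi / 2)\<bar> + \<bar>h 0\<bar> + K * (pi / 2)) / z"
      unfolding e_def by (simp add: add_divide_distrib)
  qed
qed

text \<open>With $z = 2\sqrt t$, the main part scaled by $\sqrt z$ approaches $e^{iz} \sqrt\pi/(1 + i)$ and the
rest is $O(z^{-1/2})$; taking real parts, $1/(1 + i) = e^{-i\pi/4}/\sqrt 2$ produces the phase shift.\<close>
lemma bessel_clifford_asymptotic_neg:
  "((\<lambda>t. bessel_clifford (- t) / (1 + t) powr (- (1 / 4)) - cos (2 * sqrt t - pi / 4) / sqrt pi) \<longlongrightarrow> 0) at_top"
proof -
  obtain F :: "complex \<Rightarrow> complex" where F: "\<And>w. (F has_field_derivative exp (- w\<^sup>2)) (at w)"
    using gaussian_primitive by blast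
  obtain C where C: "\<And>z. z > 0 \<Longrightarrow> norm (integral {0..pi/2}
       (\<lambda>\<theta>. exp (\<i> * of_real (z * cos \<theta>)) * of_real (1 - cos (\<theta> / 2)))) \<le> C / z"
    using nonstationary_part_bound by blast
  define K where "K z = integral {0..pi/2} (\<lambda>\<theta>. exp (\<i> * of_real (z * cos \<theta>)))" for z
  define P where "P z = 2 / (1 + \<i>) * (F ((1 + \<i>) * of_real (sqrt z / sqrt 2)) - F 0)" for z
  define Q where "Q z = integral {0..pi/2} (\<lambda>\<theta>. exp (\<i> * of_real (z * cos \<theta>)) * of_real (1 - cos (\<theta> / 2)))" for z
  have K: "of_real (sqrt z) * K z = exp (\<i> * of_real z) * P z + of_real (sqrt z) * Q z" if z: "z > 0" for z
  proof -
    have "((\<lambda>\<theta>. exp (\<i> * of_real (z * cos \<theta>)) * of_real (1 - cos (\<theta> / 2))) has_integral Q z) {0..pi/2}"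
      unfolding Q_def by (intro integrable_integral integrable_continuous_interval continuous_intros) auto
    from has_integral_add[OF stationary_phase_main_part[OF F z] this]
    have "((\<lambda>\<theta>. exp (\<i> * of_real (z * cos \<theta>))) has_integral
        (exp (\<i> * of_real z) * (2 / ((1 + \<i>) * of_real (sqrt z)))
              * (F ((1 + \<i>) * of_real (sqrt z / sqrt 2)) - F 0) + Q z)) {0..pi/2}"
      by (simp add: algebra_simps)
    then have "K z = exp (\<i> * of_real z) * (2 / ((1 + \<i>) * of_real (sqrt z)))
              * (F ((1 + \<i>) * of_real (sqrt z / sqrt 2)) - F 0) + Q z"
      unfolding K_def by (rule integral_unique)
    moreover have "s * (e * (2 / (c * s)) * d + q) = e * (2 / c * d) + s * q"
      if "c \<noteq> 0" "s \<noteq> 0" for s e c d q :: complex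
      using that by (simp add: field_simps)
    moreover have "1 + \<i> \<noteq> 0" "of_real (sqrt z) \<noteq> (0 :: complex)"
      using z by (simp_all add: complex_eq_iff)
    ultimately show ?thesis unfolding P_def by metis
  qed
  have bessel: "bessel_clifford (- t) = 2 / pi * Re (K (2 * sqrt t))" if "t > 0" for t
  proof -
    have "integrable lborel (\<lambda>\<theta>. indicator {0..pi/2} \<theta> * cos (2 * sqrt t * cos \<theta>))"
      and "(\<integral>\<theta>. indicator {0..pi/2} \<theta> * cos (2 * sqrt t * cos \<theta>) \<partial>lborel) = pi / 2 * bessel_clifford (- t)"
      using has_bochner_integral_bessel_clifford_cos[of t] that by (simp_all only: has_bochner_integral_iff less_imp_le)
    then have "((\<lambda>\<theta>. indicator {0..pi/2} \<theta> * cos (2 * sqrt t * cos \<theta>)) has_integral (pi / 2 * bessel_clifford (- t))) UNIV"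
      using has_integral_integral_lborel by metis
    then have "((\<lambda>\<theta>. if \<theta> \<in> {0..pi/2} then cos (2 * sqrt t * cos \<theta>) else 0) has_integral (pi / 2 * bessel_clifford (- t))) UNIV"
      by (rule has_integral_eq[rotated]) (simp add: indicator_def)
    then have 1: "((\<lambda>\<theta>. cos (2 * sqrt t * cos \<theta>)) has_integral (pi / 2 * bessel_clifford (- t))) {0..pi/2}"
      by (simp only: has_integral_restrict_UNIV)
    have "((\<lambda>\<theta>. exp (\<i> * of_real (2 * sqrt t * cos \<theta>))) has_integral K (2 * sqrt t)) {0..pi/2}"
      unfolding K_def by (intro integrable_integral integrable_continuous_interval continuous_intros)
    then have "((\<lambda>\<theta>. Re (exp (\<i> * of_real (2 * sqrt t * cos \<theta>)))) has_integral Re (K (2 * sqrt t))) {0..pi/2}"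
      by (rule has_integral_Re)
    then have "((\<lambda>\<theta>. cos (2 * sqrt t * cos \<theta>)) has_integral Re (K (2 * sqrt t))) {0..pi/2}"
      by (simp add: Re_exp)
    from has_integral_unique[OF 1 this] show ?thesis by (simp add: field_simps)
  qed
  have P: "((\<lambda>z. P z - 2 / (1 + \<i>) * of_real (sqrt pi / 2)) \<longlongrightarrow> 0) at_top"
  proof -
    have "filterlim (\<lambda>z. sqrt z / sqrt 2) at_top at_top" by real_asymp
    from filterlim_compose[OF fresnel_limit[OF F] this]
    have "(P \<longlongrightarrow> 2 / (1 + \<i>) * of_real (sqrt pi / 2)) at_top"
      unfolding P_def[abs_def] by (intro tendsto_mult_left)
    then show ?thesis by (rule LIM_zero)
  qed
  have Q: "((\<lambda>z. of_real (sqrt z) * Q z) \<longlongrightarrow> 0) at_top"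
  proof (rule Lim_null_comparison)
    show "eventually (\<lambda>z. norm (of_real (sqrt z) * Q z) \<le> sqrt z * (C / z)) at_top"
      using eventually_gt_at_top[of 0]
    proof eventually_elim
      case (elim z)
      then show ?case unfolding norm_mult Q_def by (intro mult_mono C) auto
    qed
    show "((\<lambda>z. sqrt z * (C / z)) \<longlongrightarrow> 0) at_top" by real_asymp
  qed
  have main: "Re (exp (\<i> * of_real z) * (2 / (1 + \<i>) * of_real (sqrt pi / 2))) = sqrt pi / sqrt 2 * cos (z - pi / 4)" for z
  proof -
    have "2 / (1 + \<i>) = 1 - \<i>" by (subst nonzero_divide_eq_eq) (simp_all add: complex_eq_iff)
    then have "Re (exp (\<i> * of_real z) * (2 / (1 + \<i>) * of_real (sqrt pi / 2))) = sqrt pi / 2 * (cos z + sin z)"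
      by (simp add: Re_exp Im_exp distrib_left mult.commute)
    moreover have "cos (z - pi / 4) = (cos z + sin z) * (1 / sqrt 2)"
      unfolding cos_diff cos_45 sin_45 sqrt_2_half by (rule distrib_right[symmetric])
    ultimately show ?thesis by simp
  qed
  have "((\<lambda>z. exp (\<i> * of_real z) * (P z - 2 / (1 + \<i>) * of_real (sqrt pi / 2)) + of_real (sqrt z) * Q z) \<longlongrightarrow> 0 + 0) at_top"
    by (intro tendsto_add Q Lim_null_comparison[OF _ tendsto_norm_zero[OF P]]) (simp add: norm_mult)
  from tendsto_mult_right_zero[OF tendsto_Re[OF this, simplified], of "2 / pi"]
  have "((\<lambda>z. 2 / pi * Re (exp (\<i> * of_real z) * (P z - 2 / (1 + \<i>) * of_real (sqrt pi / 2)) + of_real (sqrt z) * Q z)) \<longlongrightarrow> 0) at_top"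
    by simp
  moreover have "filterlim (\<lambda>t. 2 * sqrt t) at_top at_top" by real_asymp
  ultimately have "((\<lambda>t. 2 / pi * Re (exp (\<i> * of_real (2 * sqrt t)) * (P (2 * sqrt t) - 2 / (1 + \<i>) * of_real (sqrt pi / 2)) + of_real (sqrt (2 * sqrt t)) * Q (2 * sqrt t))) \<longlongrightarrow> 0) at_top"
    by (rule filterlim_compose)
  then have 1: "((\<lambda>t. sqrt (2 * sqrt t) * bessel_clifford (- t) - 2 / pi * (sqrt pi / sqrt 2 * cos (2 * sqrt t - pi / 4))) \<longlongrightarrow> 0) at_top"
  proof (rule Lim_transform_eventually)
    show "eventually (\<lambda>t. 2 / pi * Re (exp (\<i> * of_real (2 * sqrt t)) * (P (2 * sqrt t) - 2 / (1 + \<i>) * of_real (sqrt pi / 2)) + of_real (sqrt (2 * sqrt t)) * Q (2 * sqrt t))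
        = sqrt (2 * sqrt t) * bessel_clifford (- t) - 2 / pi * (sqrt pi / sqrt 2 * cos (2 * sqrt t - pi / 4))) at_top"
      using eventually_gt_at_top[of 0]
    proof eventually_elim
      case (elim t)
      define z where "z = 2 * sqrt t"
      have z: "z > 0" using elim by (simp add: z_def)
      have "exp (\<i> * of_real z) * (P z - 2 / (1 + \<i>) * of_real (sqrt pi / 2)) + of_real (sqrt z) * Q z
         = of_real (sqrt z) * K z - exp (\<i> * of_real z) * (2 / (1 + \<i>) * of_real (sqrt pi / 2))"
        unfolding K[OF z] by (simp only: right_diff_distrib) simp
      then have "Re (exp (\<i> * of_real z) * (P z - 2 / (1 + \<i>) * of_real (sqrt pi / 2)) + of_real (sqrt z) * Q z)
         = Re (of_real (sqrt z) * K z) - Re (exp (\<i> * of_real z) * (2 / (1 + \<i>) * of_real (sqrt pi / 2)))"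
        by (simp only: minus_complex.sel)
      also have "\<dots> = sqrt z * Re (K z) - sqrt pi / sqrt 2 * cos (z - pi / 4)"
        unfolding main by simp
      finally show ?case
        unfolding z_def[symmetric] bessel[OF elim] by (simp add: right_diff_distrib mult.left_commute)
    qed
  qed
  have 2: "((\<lambda>t::real. (1 + t) powr (1 / 4) / sqrt (2 * sqrt t)) \<longlongrightarrow> 1 / sqrt 2) at_top"
    by (real_asymp simp: powr_half_sqrt inverse_eq_divide)
  have 3: "((\<lambda>t. cos (2 * sqrt t - pi / 4) / sqrt pi * (sqrt 2 * ((1 + t) powr (1 / 4) / sqrt (2 * sqrt t)) - 1)) \<longlongrightarrow> 0) at_top"
  proof (rule Lim_null_comparison)
    show "eventually (\<lambda>t. norm (cos (2 * sqrt t - pi / 4) / sqrt pi * (sqrt 2 * ((1 + t) powr (1 / 4) / sqrt (2 * sqrt t)) - 1))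
        \<le> 1 / sqrt pi * \<bar>sqrt 2 * ((1 + t) powr (1 / 4) / sqrt (2 * sqrt t)) - 1\<bar>) at_top"
      unfolding real_norm_def abs_mult abs_divide
      by (intro always_eventually allI mult_right_mono) (auto intro!: divide_right_mono)
    have "((\<lambda>t. 1 / sqrt pi * \<bar>sqrt 2 * ((1 + t) powr (1 / 4) / sqrt (2 * sqrt t)) - 1\<bar>) \<longlongrightarrow> 1 / sqrt pi * \<bar>sqrt 2 * (1 / sqrt 2) - 1\<bar>) at_top"
      by (intro tendsto_intros 2)
    then show "((\<lambda>t. 1 / sqrt pi * \<bar>sqrt 2 * ((1 + t) powr (1 / 4) / sqrt (2 * sqrt t)) - 1\<bar>) \<longlongrightarrow> 0) at_top"
      by simp
  qed
  have "((\<lambda>t. (sqrt (2 * sqrt t) * bessel_clifford (- t) - 2 / pi * (sqrt pi / sqrt 2 * cos (2 * sqrt t - pi / 4))) * ((1 + t) powr (1 / 4) / sqrt (2 * sqrt t))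
      + cos (2 * sqrt t - pi / 4) / sqrt pi * (sqrt 2 * ((1 + t) powr (1 / 4) / sqrt (2 * sqrt t)) - 1)) \<longlongrightarrow> 0 * (1 / sqrt 2) + 0) at_top"
    by (intro tendsto_add tendsto_mult 1 2 3)
  then have "((\<lambda>t. (sqrt (2 * sqrt t) * bessel_clifford (- t) - 2 / pi * (sqrt pi / sqrt 2 * cos (2 * sqrt t - pi / 4))) * ((1 + t) powr (1 / 4) / sqrt (2 * sqrt t))
      + cos (2 * sqrt t - pi / 4) / sqrt pi * (sqrt 2 * ((1 + t) powr (1 / 4) / sqrt (2 * sqrt t)) - 1)) \<longlongrightarrow> 0) at_top"
    by simp
  then show ?thesis
  proof (rule Lim_transform_eventually)
    have const: "2 / pi * (sqrt pi / sqrt 2 * y) = sqrt 2 * (y / sqrt pi)" for y :: real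
    proof -
      have "2 / pi * (sqrt pi / sqrt 2 * y) = (2 / sqrt 2) * (sqrt pi / pi) * y" by (simp add: mult_ac)
      also have "2 / sqrt 2 = sqrt 2" by (rule real_div_sqrt) simp
      also have "sqrt pi / pi = 1 / sqrt pi" by (rule sqrt_divide_self_eq[THEN trans]) (auto simp: divide_inverse)
      finally show ?thesis by simp
    qed
    show "eventually (\<lambda>t. (sqrt (2 * sqrt t) * bessel_clifford (- t) - 2 / pi * (sqrt pi / sqrt 2 * cos (2 * sqrt t - pi / 4))) * ((1 + t) powr (1 / 4) / sqrt (2 * sqrt t))
      + cos (2 * sqrt t - pi / 4) / sqrt pi * (sqrt 2 * ((1 + t) powr (1 / 4) / sqrt (2 * sqrt t)) - 1)
      = bessel_clifford (- t) / (1 + t) powr (- (1 / 4)) - cos (2 * sqrt t - pi / 4) / sqrt pi) at_top"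
      using eventually_gt_at_top[of 0]
    proof eventually_elim
      case (elim t)
      define s where "s = sqrt (2 * sqrt t)"
      define w where "w = (1 + t) powr (1 / 4)"
      define y where "y = cos (2 * sqrt t - pi / 4) / sqrt pi"
      have "s > 0" using elim by (simp add: s_def)
      then have "(s * b - r * y) * (w / s) + y * (r * (w / s) - 1) = b * w - y" for b r
        by (simp add: field_simps)
      moreover have "bessel_clifford (- t) / (1 + t) powr (- (1 / 4)) = bessel_clifford (- t) * w"
        unfolding w_def powr_minus by (rule divide_inverse[THEN trans]) simp
      ultimately show ?case
        unfolding const s_def[symmetric] w_def[symmetric] y_def[symmetric] by simp
    qed
  qed
qed

lemma bessel_clifford_bound_neg:
  obtains M where "\<And>t. t > 0 \<Longrightarrow> \<bar>bessel_clifford (- t)\<bar> \<le> M * (1 + t) powr (- (1 / 4))"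
proof -
  define f where "f t = bessel_clifford (- t) / (1 + t) powr (- (1 / 4)) - cos (2 * sqrt t - pi / 4) / sqrt pi" for t
  have "isCont f t" if "t \<ge> 0" for t
    unfolding f_def using that by (intro continuous_intros isCont_o2[OF _ isCont_bessel_clifford]) auto
  from continuous_tendsto_imp_bounded[OF this bessel_clifford_asymptotic_neg[folded f_def]]
  obtain M where M: "\<And>t. t \<ge> 0 \<Longrightarrow> \<bar>f t\<bar> \<le> M" by blast
  show ?thesis
  proof (rule that)
    fix t :: real assume t: "t > 0"
    have "\<bar>cos (2 * sqrt t - pi / 4) / sqrt pi\<bar> \<le> 1 / 1"
      unfolding abs_divide using pi_gt3 by (intro frac_le) auto
    then have "\<bar>bessel_clifford (- t) / (1 + t) powr (- (1 / 4))\<bar> \<le> M + 1"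
      using M[of t] t unfolding f_def by linarith
    then show "\<bar>bessel_clifford (- t)\<bar> \<le> (M + 1) * (1 + t) powr (- (1 / 4))"
      using t by (simp add: abs_divide divide_le_eq)
  qed
qed

section \<open>The amplitudes under bounded shifts\<close>

text \<open>Follows from $1 + L \le (1 + |x|)(1 + L + x)$, which also covers shifts that bring $L + x$ close to 0.\<close>
lemma powr_shift_ratio_le:
  fixes L x a :: real
  assumes L: "L > 0" and x: "x > - L" and a: "a \<ge> 0"
  shows "(1 + (L + x)) powr (- a) / (1 + L) powr (- a) \<le> exp (a * \<bar>x\<bar>)"
proof -
  have pos: "1 + (L + x) > 0" "1 + L > 0" using L x by auto
  have "1 + L \<le> (1 + \<bar>x\<bar>) * (1 + (L + x))"
  proof -
    have "0 \<le> \<bar>x\<bar> * (L + x)" using x by (intro mult_nonneg_nonneg) auto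
    then show ?thesis using abs_ge_minus_self[of x] by (simp add: algebra_simps)
  qed
  also have "\<dots> \<le> exp \<bar>x\<bar> * (1 + (L + x))"
    using pos exp_ge_add_one_self[of "\<bar>x\<bar>"] by (intro mult_right_mono) auto
  finally have "(1 + L) / (1 + (L + x)) \<le> exp \<bar>x\<bar>" using pos by (simp add: divide_le_eq)
  then have "((1 + L) / (1 + (L + x))) powr a \<le> exp \<bar>x\<bar> powr a"
    using pos a by (intro powr_mono2) auto
  moreover have "(1 + (L + x)) powr (- a) / (1 + L) powr (- a) = ((1 + L) / (1 + (L + x))) powr a"
    using pos by (simp add: powr_divide powr_minus inverse_eq_divide)
  ultimately show ?thesis by (simp add: powr_def mult.commute)
qed

lemma powr_half_weight_shift_bound:
  "eventually (\<lambda>L. \<forall>x > -L. (1 + (L + x)) powr (- (1 / 2)) / (1 + L) powr (- (1 / 2)) \<le> 1 * exp (\<bar>x\<bar> / 2)) (at_top :: real filter)"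
  using eventually_gt_at_top[of 0]
proof eventually_elim
  case (elim L)
  show ?case
  proof (intro allI impI)
    fix x assume "x > - L"
    then have "(1 + (L + x)) powr (- (1 / 2)) / (1 + L) powr (- (1 / 2)) \<le> exp (1 / 2 * \<bar>x\<bar>)"
      using elim by (intro powr_shift_ratio_le) auto
    also have "\<dots> = 1 * exp (\<bar>x\<bar> / 2)" by simp
    finally show "(1 + (L + x)) powr (- (1 / 2)) / (1 + L) powr (- (1 / 2)) \<le> 1 * exp (\<bar>x\<bar> / 2)" .
  qed
qed

lemma powr_quarter_weight_shift_bound:
  "eventually (\<lambda>L. \<forall>x > -L. (1 + (L + x)) powr (- (1 / 4)) / (1 + L) powr (- (1 / 4)) \<le> 1 * exp (\<bar>x\<bar> / 2)) (at_top :: real filter)"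
  using eventually_gt_at_top[of 0]
proof eventually_elim
  case (elim L)
  show ?case
  proof (intro allI impI)
    fix x assume "x > - L"
    then have "(1 + (L + x)) powr (- (1 / 4)) / (1 + L) powr (- (1 / 4)) \<le> exp (1 / 4 * \<bar>x\<bar>)"
      using elim by (intro powr_shift_ratio_le) auto
    also have "\<dots> \<le> 1 * exp (\<bar>x\<bar> / 2)" by simp
    finally show "(1 + (L + x)) powr (- (1 / 4)) / (1 + L) powr (- (1 / 4)) \<le> 1 * exp (\<bar>x\<bar> / 2)" .
  qed
qed

text \<open>The derivative of $2\sqrt L$ is small for large $L$. The threshold 64 gives the factor $1/4$, which together
with the $1/4$ from the algebraic factor of the amplitude adds up to the permitted exponent $|x|/2$.\<close>
lemma sqrt_shift_le:
  fixes L x :: real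
  assumes L: "L \<ge> 64" and x: "x > - L"
  shows "2 * sqrt (L + x) - 2 * sqrt L \<le> \<bar>x\<bar> / 4"
proof -
  have s: "sqrt L \<ge> 8" using real_sqrt_le_mono[OF L] by simp
  have "sqrt L * (2 * sqrt (L + x)) \<le> L + (L + x)"
    using zero_le_power2[of "sqrt (L + x) - sqrt L"] L x by (simp add: power2_diff mult_ac)
  moreover have "sqrt L * (2 * sqrt L) = 2 * L" using L by simp
  ultimately have le: "sqrt L * (2 * sqrt (L + x) - 2 * sqrt L) \<le> \<bar>x\<bar>"
    unfolding right_diff_distrib by linarith
  show ?thesis
  proof (cases "x \<ge> 0")
    case True
    then have "8 * (2 * sqrt (L + x) - 2 * sqrt L) \<le> sqrt L * (2 * sqrt (L + x) - 2 * sqrt L)"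
      using s by (intro mult_right_mono) auto
    from order_trans[OF this le] have "8 * (2 * sqrt (L + x) - 2 * sqrt L) \<le> \<bar>x\<bar>" .
    moreover have "d \<le> u / 4" if "8 * d \<le> u" "0 \<le> u" for d u :: real
      using that by linarith
    ultimately show ?thesis by (meson abs_ge_zero)
  next
    case False
    then have "sqrt (L + x) \<le> sqrt L" by simp
    then show ?thesis by linarith
  qed
qed

lemma exp_sqrt_weight_shift_bound:
  "eventually (\<lambda>L. \<forall>x > -L. (1 + (L + x)) powr (- (1 / 4)) * exp (2 * sqrt (L + x)) / ((1 + L) powr (- (1 / 4)) * exp (2 * sqrt L))
      \<le> 1 * exp (\<bar>x\<bar> / 2)) (at_top :: real filter)"
  using eventually_ge_at_top[of 64]
proof eventually_elim
  case (elim L)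
  show ?case
  proof (intro allI impI)
    fix x assume x: "x > - L"
    have "(1 + (L + x)) powr (- (1 / 4)) * exp (2 * sqrt (L + x)) / ((1 + L) powr (- (1 / 4)) * exp (2 * sqrt L))
       = (1 + (L + x)) powr (- (1 / 4)) / (1 + L) powr (- (1 / 4)) * exp (2 * sqrt (L + x) - 2 * sqrt L)"
      by (simp add: exp_diff)
    also have "\<dots> \<le> exp (1 / 4 * \<bar>x\<bar>) * exp (\<bar>x\<bar> / 4)"
      using powr_shift_ratio_le[of L x "1 / 4"] sqrt_shift_le[OF elim x] elim x
      by (intro mult_mono) auto
    also have "\<dots> = 1 * exp (\<bar>x\<bar> / 2)" by (simp add: exp_add[symmetric])
    finally show "(1 + (L + x)) powr (- (1 / 4)) * exp (2 * sqrt (L + x)) / ((1 + L) powr (- (1 / 4)) * exp (2 * sqrt L))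
      \<le> 1 * exp (\<bar>x\<bar> / 2)" .
  qed
qed

section \<open>The four asymptotic relations\<close>

lemma abs_cos_diff_le: "\<bar>cos x - cos y\<bar> \<le> \<bar>x - y\<bar>" for x y :: real
proof -
  have "\<bar>cos x - cos y\<bar> = 2 * (\<bar>sin ((x + y) / 2)\<bar> * \<bar>sin ((y - x) / 2)\<bar>)"
    by (simp add: cos_diff_cos abs_mult)
  also have "\<dots> \<le> 2 * (1 * \<bar>(y - x) / 2\<bar>)"
    by (intro mult_left_mono mult_mono abs_sin_x_le_abs_x) auto
  finally show ?thesis by simp
qed

text \<open>The transfer principle is applied to $1 - e^{-\sqrt k}$ because its inverse transform is a pure error
function that tends to 0. The term $k = 0$ vanishes, and the constant 1 has a vanishing full
alternating sum, which accounts for the change of sign.\<close>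
lemma alternating_binomial_sum_exp_neg_sqrt:
  "(\<lambda>n. (\<Sum>k=0..n. real (n choose k) * (-1) ^ k * exp (- sqrt (real k))) * sqrt (pi * ln (real n))) \<longlonglongrightarrow> 1"
proof -
  define T where "T n = (\<Sum>k=1..n. real (n choose k) * (-1) ^ k * (1 - exp (- sqrt (real k))))" for n :: nat
  have "(\<lambda>n. T n / (1 + ln (real n)) powr (- (1 / 2)) + 1 / sqrt pi) \<longlonglongrightarrow> 0"
    unfolding T_def
  proof (rule alternating_binomial_sum_asymptotic[where B = "\<lambda>t. erf (1 / (2 * sqrt t))" and G = "1 / sqrt pi" and g = "\<lambda>_. 1 / sqrt pi"
        and w = "\<lambda>t. (1 + t) powr (- (1 / 2))" and M = 2, OF _ _ _ _ powr_half_weight_shift_bound _ erf_asymptotic])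
    show "((\<lambda>L::real. (1 + (L + x)) powr (- (1 / 2)) / (1 + L) powr (- (1 / 2))) \<longlongrightarrow> 1) at_top" for x
      by real_asymp
  qed (auto intro!: has_bochner_integral_erf_laplace erf_bound)
  then have "(\<lambda>n. 1 / sqrt pi - (T n / (1 + ln (real n)) powr (- (1 / 2)) + 1 / sqrt pi)) \<longlonglongrightarrow> 1 / sqrt pi - 0"
    by (intro tendsto_intros)
  moreover have "(\<lambda>n. sqrt (pi * ln (real n)) * (1 + ln (real n)) powr (- (1 / 2))) \<longlonglongrightarrow> sqrt pi"
    by (real_asymp simp: powr_half_sqrt)
  ultimately have "(\<lambda>n. (1 / sqrt pi - (T n / (1 + ln (real n)) powr (- (1 / 2)) + 1 / sqrt pi))
      * (sqrt (pi * ln (real n)) * (1 + ln (real n)) powr (- (1 / 2)))) \<longlonglongrightarrow> (1 / sqrt pi - 0) * sqrt pi"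
    by (rule tendsto_mult)
  also have "(1 / sqrt pi - 0) * sqrt pi = 1" by simp
  finally show ?thesis
  proof (rule Lim_transform_eventually)
    show "eventually (\<lambda>n. (1 / sqrt pi - (T n / (1 + ln (real n)) powr (- (1 / 2)) + 1 / sqrt pi))
      * (sqrt (pi * ln (real n)) * (1 + ln (real n)) powr (- (1 / 2)))
       = (\<Sum>k=0..n. real (n choose k) * (-1) ^ k * exp (- sqrt (real k))) * sqrt (pi * ln (real n))) sequentially"
      using eventually_gt_at_top[of 1]
    proof eventually_elim
      case (elim n)
      have "T n = (\<Sum>k=0..n. real (n choose k) * (-1) ^ k * (1 - exp (- sqrt (real k))))"
        unfolding T_def by (simp add: sum.atLeast_Suc_atMost[of 0])
      also have "(\<Sum>k=0..n. real (n choose k) * (-1) ^ k * (1 - exp (- sqrt (real k))))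
          = (\<Sum>k\<le>n. (-1) ^ k * real (n choose k)) - (\<Sum>k=0..n. real (n choose k) * (-1) ^ k * exp (- sqrt (real k)))"
        unfolding atLeast0AtMost by (subst sum_subtractf[symmetric]) (simp add: algebra_simps)
      also have "(\<Sum>k\<le>n. (-1) ^ k * real (n choose k)) = 0"
        using elim by (intro choose_alternating_sum) auto
      finally have "(\<Sum>k=0..n. real (n choose k) * (-1) ^ k * exp (- sqrt (real k))) = - T n" by simp
      moreover have "(1 + ln (real n)) powr (- (1 / 2)) \<noteq> 0" using elim by (simp add: add_nonneg_eq_0_iff)
      then have "(c - (T n / (1 + ln (real n)) powr (- (1 / 2)) + c)) * (s * (1 + ln (real n)) powr (- (1 / 2))) = - T n * s" for c s
        by simp
      ultimately show ?case by (simp only:)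
    qed
  qed
qed

lemma alternating_binomial_sum_exp_sqrt:
  "(\<lambda>n. (\<Sum>k=0..n. real (n choose k) * (-1) ^ k * exp (sqrt (real k))) * sqrt (pi * ln (real n))) \<longlonglongrightarrow> -1"
proof -
  define S where "S n = (\<Sum>k\<le>n. real (n choose k) * (-1) ^ k * cosh (sqrt (real k)))" for n :: nat
  have "(\<lambda>n. S n * sqrt (pi * ln (real n))) \<longlonglongrightarrow> 0"
  proof (rule Lim_null_comparison)
    show "eventually (\<lambda>n. norm (S n * sqrt (pi * ln (real n))) \<le> exp 4 / 2 ^ n * sqrt (pi * ln (real n))) sequentially"
      using eventually_gt_at_top[of 0]
    proof eventually_elim
      case (elim n)
      have s: "0 \<le> sqrt (pi * ln (real n))" using elim by simp
      show ?case
        unfolding real_norm_def abs_mult abs_of_nonneg[OF s] S_def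
        by (rule mult_right_mono[OF alternating_binomial_sum_cosh_sqrt_bound s])
    qed
    show "(\<lambda>n. exp 4 / 2 ^ n * sqrt (pi * ln (real n))) \<longlonglongrightarrow> 0" by real_asymp
  qed
  from tendsto_diff[OF tendsto_mult_right[OF this, of 2] alternating_binomial_sum_exp_neg_sqrt]
  have "(\<lambda>n. 2 * (S n * sqrt (pi * ln (real n))) - (\<Sum>k=0..n. real (n choose k) * (-1) ^ k * exp (- sqrt (real k))) * sqrt (pi * ln (real n)))
      \<longlonglongrightarrow> -1"
    by (simp add: mult.commute)
  moreover have "2 * (S n * sqrt (pi * ln (real n))) - (\<Sum>k=0..n. real (n choose k) * (-1) ^ k * exp (- sqrt (real k))) * sqrt (pi * ln (real n))
     = (\<Sum>k=0..n. real (n choose k) * (-1) ^ k * exp (sqrt (real k))) * sqrt (pi * ln (real n))" for n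
  proof -
    have exp_eq: "exp y = 2 * cosh y - exp (- y)" for y :: real
      by (simp flip: cosh_plus_sinh cosh_minus_sinh)
    have "a * exp y = 2 * (a * cosh y) - a * exp (- y)" for a y :: real
      by (subst exp_eq) (simp add: right_diff_distrib)
    then have "(\<Sum>k=0..n. real (n choose k) * (-1) ^ k * exp (sqrt (real k)))
       = 2 * S n - (\<Sum>k=0..n. real (n choose k) * (-1) ^ k * exp (- sqrt (real k)))"
      unfolding S_def sum_distrib_left atLeast0AtMost sum_subtractf[symmetric]
      by (intro sum.cong refl)
    then show ?thesis by (simp only: left_diff_distrib mult.assoc)
  qed
  ultimately show ?thesis by simp
qed

lemma alternating_binomial_sum_exp_inverse:
  "(\<lambda>n. (\<Sum>k=1..n. real (n choose k) * (-1) ^ k * exp (1 / real k)) * (2 * sqrt pi * ln (real n) powr (1 / 4) / exp (2 * sqrt (ln (real n)))))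
     \<longlonglongrightarrow> -1"
proof -
  define T where "T n = (\<Sum>k=1..n. real (n choose k) * (-1) ^ k * exp (1 / real k))" for n :: nat
  obtain M where M: "\<And>t. t > 0 \<Longrightarrow> \<bar>bessel_clifford t\<bar> \<le> M * ((1 + t) powr (- (1 / 4)) * exp (2 * sqrt t))"
    using bessel_clifford_bound_pos by blast
  have asymp: "((\<lambda>t. bessel_clifford t / ((1 + t) powr (- (1 / 4)) * exp (2 * sqrt t)) - 1 / (2 * sqrt pi)) \<longlongrightarrow> 0) at_top"
    by (rule LIM_zero[OF bessel_clifford_asymptotic_pos])
  have "(\<lambda>n. T n / ((1 + ln (real n)) powr (- (1 / 4)) * exp (2 * sqrt (ln (real n)))) + 1 / (2 * sqrt pi)) \<longlonglongrightarrow> 0"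
    unfolding T_def
  proof (rule alternating_binomial_sum_asymptotic[where B = bessel_clifford and G = "1 / (2 * sqrt pi)" and g = "\<lambda>_. 1 / (2 * sqrt pi)"
        and w = "\<lambda>t. (1 + t) powr (- (1 / 4)) * exp (2 * sqrt t)", OF _ _ _ _ exp_sqrt_weight_shift_bound M asymp])
    show "((\<lambda>L::real. (1 + (L + x)) powr (- (1 / 4)) * exp (2 * sqrt (L + x)) / ((1 + L) powr (- (1 / 4)) * exp (2 * sqrt L))) \<longlongrightarrow> 1) at_top" for x
      by real_asymp
    show "has_bochner_integral lborel (\<lambda>t. indicator {0<..} t * (bessel_clifford t * exp (- (real k * t)))) (exp (1 / real k) / real k)"
      if "1 \<le> k" for k :: nat
      using has_bochner_integral_bessel_clifford_laplace[of "real k" 1] that by simp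
  qed auto
  moreover have "(\<lambda>n. ln (real n) powr (1 / 4) * (1 + ln (real n)) powr (- (1 / 4))) \<longlonglongrightarrow> 1" by real_asymp
  ultimately have "(\<lambda>n. 2 * sqrt pi * ((T n / ((1 + ln (real n)) powr (- (1 / 4)) * exp (2 * sqrt (ln (real n)))) + 1 / (2 * sqrt pi)) - 1 / (2 * sqrt pi))
       * (ln (real n) powr (1 / 4) * (1 + ln (real n)) powr (- (1 / 4)))) \<longlonglongrightarrow> 2 * sqrt pi * (0 - 1 / (2 * sqrt pi)) * 1"
    by (intro tendsto_intros)
  also have "2 * sqrt pi * (0 - 1 / (2 * sqrt pi)) * 1 = -1" by simp
  finally show ?thesis
  proof (rule Lim_transform_eventually)
    show "eventually (\<lambda>n. 2 * sqrt pi * ((T n / ((1 + ln (real n)) powr (- (1 / 4)) * exp (2 * sqrt (ln (real n)))) + 1 / (2 * sqrt pi)) - 1 / (2 * sqrt pi))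
       * (ln (real n) powr (1 / 4) * (1 + ln (real n)) powr (- (1 / 4)))
      = (\<Sum>k=1..n. real (n choose k) * (-1) ^ k * exp (1 / real k)) * (2 * sqrt pi * ln (real n) powr (1 / 4) / exp (2 * sqrt (ln (real n))))) sequentially"
      using eventually_gt_at_top[of 1]
    proof eventually_elim
      case (elim n)
      have "(1 + ln (real n)) powr (- (1 / 4)) \<noteq> 0" using elim by (simp add: add_nonneg_eq_0_iff)
      then show ?case unfolding T_def[symmetric] by simp
    qed
  qed
qed

text \<open>The transfer principle for $J_0(2\sqrt t)$. The oscillating factor is insensitive to bounded shifts
because $\sqrt{L + x} - \sqrt L \to 0$ and the cosine is Lipschitz continuous.\<close>
lemma alternating_binomial_sum_exp_neg_inverse:
  "(\<lambda>n. (\<Sum>k=1..n. real (n choose k) * (-1) ^ k * exp (- (1 / real k))) * ln (real n) powr (1 / 4)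
       + cos (2 * sqrt (ln (real n)) - pi / 4) / sqrt pi) \<longlonglongrightarrow> 0"
proof -
  define T where "T n = (\<Sum>k=1..n. real (n choose k) * (-1) ^ k * exp (- (1 / real k)))" for n :: nat
  define g where "g t = cos (2 * sqrt t - pi / 4) / sqrt pi" for t
  obtain M where M: "\<And>t. t > 0 \<Longrightarrow> \<bar>bessel_clifford (- t)\<bar> \<le> M * (1 + t) powr (- (1 / 4))"
    using bessel_clifford_bound_neg by blast
  have g_bound: "\<bar>g t\<bar> \<le> 1 / sqrt pi" for t
    unfolding g_def abs_divide by (auto intro!: divide_right_mono)
  have lim: "(\<lambda>n. T n / (1 + ln (real n)) powr (- (1 / 4)) + g (ln (real n))) \<longlonglongrightarrow> 0"
    unfolding T_def
  proof (rule alternating_binomial_sum_asymptotic[where B = "\<lambda>t. bessel_clifford (- t)"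
        and w = "\<lambda>t. (1 + t) powr (- (1 / 4))", OF _ _ _ _ powr_quarter_weight_shift_bound M
          bessel_clifford_asymptotic_neg[folded g_def] g_bound])
    show "((\<lambda>L::real. (1 + (L + x)) powr (- (1 / 4)) / (1 + L) powr (- (1 / 4))) \<longlongrightarrow> 1) at_top" for x
      by real_asymp
    show "has_bochner_integral lborel (\<lambda>t. indicator {0<..} t * (bessel_clifford (- t) * exp (- (real k * t)))) (exp (- (1 / real k)) / real k)"
      if "1 \<le> k" for k :: nat
      using has_bochner_integral_bessel_clifford_laplace[of "real k" "-1"] that by simp
    show "((\<lambda>L. g (L + x) - g L) \<longlongrightarrow> 0) at_top" for x
    proof (rule Lim_null_comparison)
      show "eventually (\<lambda>L. norm (g (L + x) - g L) \<le> \<bar>2 * sqrt (L + x) - 2 * sqrt L\<bar> / sqrt pi) at_top"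
      proof (intro always_eventually allI)
        fix L :: real
        have "norm (g (L + x) - g L) = \<bar>cos (2 * sqrt (L + x) - pi / 4) - cos (2 * sqrt L - pi / 4)\<bar> / sqrt pi"
          unfolding g_def by (simp add: diff_divide_distrib[symmetric] abs_divide)
        also have "\<dots> \<le> \<bar>(2 * sqrt (L + x) - pi / 4) - (2 * sqrt L - pi / 4)\<bar> / sqrt pi"
          by (intro divide_right_mono abs_cos_diff_le) auto
        finally show "norm (g (L + x) - g L) \<le> \<bar>2 * sqrt (L + x) - 2 * sqrt L\<bar> / sqrt pi" by simp
      qed
      show "((\<lambda>L. \<bar>2 * sqrt (L + x) - 2 * sqrt L\<bar> / sqrt pi) \<longlongrightarrow> 0) at_top"
        by (rule tendsto_divide_zero, rule tendsto_rabs_zero) real_asymp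
    qed
  qed auto
  have ratio: "(\<lambda>n. ln (real n) powr (1 / 4) * (1 + ln (real n)) powr (- (1 / 4))) \<longlonglongrightarrow> 1" by real_asymp
  have "(\<lambda>n. g (ln (real n)) * (1 - ln (real n) powr (1 / 4) * (1 + ln (real n)) powr (- (1 / 4)))) \<longlonglongrightarrow> 0"
  proof (rule Lim_null_comparison)
    show "eventually (\<lambda>n. norm (g (ln (real n)) * (1 - ln (real n) powr (1 / 4) * (1 + ln (real n)) powr (- (1 / 4))))
         \<le> 1 / sqrt pi * \<bar>1 - ln (real n) powr (1 / 4) * (1 + ln (real n)) powr (- (1 / 4))\<bar>) sequentially"
      unfolding real_norm_def abs_mult[of "g _"]
      by (intro always_eventually allI mult_right_mono g_bound abs_ge_zero)
    have "(\<lambda>n. 1 / sqrt pi * \<bar>1 - ln (real n) powr (1 / 4) * (1 + ln (real n)) powr (- (1 / 4))\<bar>) \<longlonglongrightarrow> 1 / sqrt pi * \<bar>1 - 1\<bar>"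
      by (intro tendsto_mult tendsto_const tendsto_rabs tendsto_diff ratio)
    then show "(\<lambda>n. 1 / sqrt pi * \<bar>1 - ln (real n) powr (1 / 4) * (1 + ln (real n)) powr (- (1 / 4))\<bar>) \<longlonglongrightarrow> 0"
      by simp
  qed
  from tendsto_add[OF tendsto_mult[OF lim ratio] this]
  have "(\<lambda>n. (T n / (1 + ln (real n)) powr (- (1 / 4)) + g (ln (real n))) * (ln (real n) powr (1 / 4) * (1 + ln (real n)) powr (- (1 / 4)))
      + g (ln (real n)) * (1 - ln (real n) powr (1 / 4) * (1 + ln (real n)) powr (- (1 / 4)))) \<longlonglongrightarrow> 0"
    by simp
  then show ?thesis
    unfolding T_def[symmetric] g_def[symmetric]
  proof (rule Lim_transform_eventually)
    show "eventually (\<lambda>n. (T n / (1 + ln (real n)) powr (- (1 / 4)) + g (ln (real n))) * (ln (real n) powr (1 / 4) * (1 + ln (real n)) powr (- (1 / 4)))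
      + g (ln (real n)) * (1 - ln (real n) powr (1 / 4) * (1 + ln (real n)) powr (- (1 / 4)))
      = T n * ln (real n) powr (1 / 4) + g (ln (real n))) sequentially"
      using eventually_gt_at_top[of 1]
    proof eventually_elim
      case (elim n)
      have "(1 + ln (real n)) powr (- (1 / 4)) \<noteq> 0" using elim by (simp add: add_nonneg_eq_0_iff)
      then have "(t / (1 + ln (real n)) powr (- (1 / 4)) + y) * (l * (1 + ln (real n)) powr (- (1 / 4)))
          + y * (1 - l * (1 + ln (real n)) powr (- (1 / 4))) = t * l + y" for t y l
        by (simp add: distrib_right right_diff_distrib)
      then show ?case .
    qed
  qed
qed

theorem corollary1:
  shows "((\<lambda>n::nat. \<Sum>k=0..n. real (n choose k) * (-1) ^ k * exp (sqrt (real k)))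
           \<sim>[sequentially] (\<lambda>n. - (1 / sqrt (pi * ln (real n)))))
    \<and> ((\<lambda>n::nat. \<Sum>k=0..n. real (n choose k) * (-1) ^ k * exp (- sqrt (real k)))
           \<sim>[sequentially] (\<lambda>n. 1 / sqrt (pi * ln (real n))))
    \<and> ((\<lambda>n::nat. \<Sum>k=1..n. real (n choose k) * (-1) ^ k * exp (1 / real k))
           \<sim>[sequentially]
         (\<lambda>n. - (exp (2 * sqrt (ln (real n))) / (2 * sqrt pi * ln (real n) powr (1 / 4)))))
    \<and> ((\<lambda>n::nat. (\<Sum>k=1..n. real (n choose k) * (-1) ^ k * exp (- (1 / real k)))
             - (- (cos (2 * sqrt (ln (real n)) - 1 / 4 * pi)
                    / (sqrt pi * ln (real n) powr (1 / 4)))))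
           \<in> o[sequentially](\<lambda>n. ln (real n) powr (- (1 / 4))))"
proof (intro conjI)
  show "(\<lambda>n::nat. \<Sum>k=0..n. real (n choose k) * (-1) ^ k * exp (sqrt (real k)))
           \<sim>[sequentially] (\<lambda>n. - (1 / sqrt (pi * ln (real n))))"
    using tendsto_minus[OF alternating_binomial_sum_exp_sqrt] by (intro asymp_equivI') simp
  show "(\<lambda>n::nat. \<Sum>k=0..n. real (n choose k) * (-1) ^ k * exp (- sqrt (real k)))
           \<sim>[sequentially] (\<lambda>n. 1 / sqrt (pi * ln (real n)))"
    using alternating_binomial_sum_exp_neg_sqrt by (intro asymp_equivI') simp
  show "(\<lambda>n::nat. \<Sum>k=1..n. real (n choose k) * (-1) ^ k * exp (1 / real k))
           \<sim>[sequentially]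
         (\<lambda>n. - (exp (2 * sqrt (ln (real n))) / (2 * sqrt pi * ln (real n) powr (1 / 4))))"
    using tendsto_minus[OF alternating_binomial_sum_exp_inverse] by (intro asymp_equivI') simp
  show "(\<lambda>n::nat. (\<Sum>k=1..n. real (n choose k) * (-1) ^ k * exp (- (1 / real k)))
             - (- (cos (2 * sqrt (ln (real n)) - 1 / 4 * pi)
                    / (sqrt pi * ln (real n) powr (1 / 4)))))
           \<in> o[sequentially](\<lambda>n. ln (real n) powr (- (1 / 4)))"
  proof (rule smalloI_tendsto)
    show "eventually (\<lambda>n. ln (real n) powr (- (1 / 4)) \<noteq> 0) sequentially"
      using eventually_gt_at_top[of 1] by eventually_elim simp
    show "(\<lambda>n. ((\<Sum>k=1..n. real (n choose k) * (-1) ^ k * exp (- (1 / real k)))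
             - (- (cos (2 * sqrt (ln (real n)) - 1 / 4 * pi) / (sqrt pi * ln (real n) powr (1 / 4)))))
             / ln (real n) powr (- (1 / 4))) \<longlonglongrightarrow> 0"
      using alternating_binomial_sum_exp_neg_inverse
    proof (rule Lim_transform_eventually)
      show "eventually (\<lambda>n. (\<Sum>k=1..n. real (n choose k) * (-1) ^ k * exp (- (1 / real k))) * ln (real n) powr (1 / 4)
         + cos (2 * sqrt (ln (real n)) - pi / 4) / sqrt pi
        = ((\<Sum>k=1..n. real (n choose k) * (-1) ^ k * exp (- (1 / real k)))
             - (- (cos (2 * sqrt (ln (real n)) - 1 / 4 * pi) / (sqrt pi * ln (real n) powr (1 / 4)))))
             / ln (real n) powr (- (1 / 4))) sequentially"
        using eventually_gt_at_top[of 1]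
      proof eventually_elim
        case (elim n)
        have "(a - - (b / (c * l))) / inverse l = a * l + b / c" if "l \<noteq> 0" for a b c l :: real
        proof -
          have "(a - - (b / (c * l))) / inverse l = (a + b / (c * l)) * l" by (simp add: divide_inverse)
          also have "\<dots> = a * l + b / (c * l) * l" by (rule distrib_right)
          also have "b / (c * l) * l = b / c" using that by simp
          finally show ?thesis .
        qed
        from this[of "ln (real n) powr (1 / 4)"] show ?case
          using elim unfolding powr_minus by simp
      qed
    qed
  qed
qed

end
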